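(* Let $(K,\tau)$ be a compact Hausdorff topological space. Then the following hold. (1) If every subset of $K$ is a Borel set, i.e. $\operatorname{Bo}(K,\tau)=P(K)$, then $\operatorname{Bo}(C^*(K),w)=\operatorname{Bo}(C^*(K),\|\cdot\|)$. (2) If $\operatorname{Bo}(C^*(K),w^* )=\operatorname{Bo}(C^*(K),w)$, then $\operatorname{Bo}(C^*(K),w^* )=\operatorname{Bo}(C^*(K),\|\cdot\|)$.
   Context: $\operatorname{Bo}(T,\tau)$ denotes the Borel $\sigma$-algebra on a set $T$ generated by a topology $\tau$ on $T$, and $P(X)$ denotes the power set of $X$. $C(K)$ is the Banach space of real-valued continuous functions on $K$ with the sup-norm, and $C^*(K)$ is its topological dual. On $C^*(K)$, $\|\cdot\|$ denotes the dual norm (and the topology it induces), $w$ denotes the weak topology $\sigma(C^*(K),C^{**}(K))$, and $w^*$ denotes the weak-star topology $\sigma(C^*(K),C(K))$. *)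

theory Defs
  imports "HOL-Analysis.Analysis"
begin

definition Bo :: "'a topology \<Rightarrow> 'a set set"
  where "Bo T = sigma_sets (topspace T) {U. openin T U}"

text \<open>
  The space \<open>C(K)\<close> is the type \<open>'a \<Rightarrow>\<^sub>C real\<close> of bounded continuous functions with the
  sup-norm; over a compact space every continuous function is bounded:
\<close>

lemma continuous_on_compact_imp_bcontfun:
  fixes f :: "'a::topological_space \<Rightarrow> real"
  assumes "compact (UNIV :: 'a set)" and "continuous_on UNIV f"
  shows "f \<in> bcontfun"
  using assms compact_continuous_image compact_imp_bounded unfolding bcontfun_def by blast

type_synonym 'e dual = "'e \<Rightarrow>\<^sub>L real"

text \<open>The coarsest topology on the whole type for which all \<open>f \<in> F\<close> are continuous.\<close>

definition initial_topology :: "('e \<Rightarrow> real) set \<Rightarrow> 'e topology"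
  where "initial_topology F = topology_generated_by {f -` U | f U. f \<in> F \<and> open U}"

definition weak_topology :: "('e::real_normed_vector) topology"
  where "weak_topology = initial_topology (range (blinfun_apply :: 'e dual \<Rightarrow> 'e \<Rightarrow> real))"

definition weak_star_topology :: "('e::real_normed_vector) dual topology"
  where "weak_star_topology = initial_topology (range (\<lambda>(x :: 'e) (\<phi> :: 'e dual). blinfun_apply \<phi> x))"

end

theory Submission
  imports Defs
begin

text \<open>
  If every subset of \<open>K\<close> is Borel, then \<open>K\<close> is scattered: otherwise an irreducible map from a closed
  subset of \<open>K\<close> onto the Cantor space would give every subset of the Cantor space the Baire property.
  Over a scattered \<open>K\<close> every functional is an absolutely convergent sum of point masses, so \<open>C(K)\<^sup>*\<close> is
  \<open>\<ell>\<^sup>1(K)\<close>. There the weak topology agrees with the norm topology up to control of the norm (the Kadec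
  property), and since balls are weakly closed, norm-open sets are weakly Borel.

  For the second part, the point masses are weakly discrete: every \<open>A \<subseteq> K\<close> is the preimage under
  \<open>x \<mapsto> \<delta>\<^sub>x\<close> of a weakly open set. If that set is weak-star Borel, then \<open>A\<close> is Borel,
  because \<open>\<delta>\<close> is weak-star continuous; so the first part applies.
\<close>

subsection \<open>The Baire property in the Cantor space\<close>

text \<open>Allowing only closed sets in the cover loses nothing, since the closure of a nowhere
  dense set is nowhere dense. An arbitrary countable family, possibly empty, makes unions easy to
  handle.\<close>

definition meagre :: "'a::topological_space set \<Rightarrow> bool"
  where "meagre N \<longleftrightarrow> (\<exists>\<D>. countable \<D> \<and> (\<forall>D\<in>\<D>. closed D \<and> interior D = {}) \<and> N \<subseteq> \<Union>\<D>)"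

lemma meagre_subset: "meagre N \<Longrightarrow> M \<subseteq> N \<Longrightarrow> meagre M"
  unfolding meagre_def by (meson subset_trans)

lemma meagre_nowhere_dense: "closed D \<Longrightarrow> interior D = {} \<Longrightarrow> meagre D"
  unfolding meagre_def by (rule exI[of _ "{D}"]) auto

lemma meagre_UN:
  assumes "countable I" "\<And>i. i \<in> I \<Longrightarrow> meagre (N i)"
  shows "meagre (\<Union>i\<in>I. N i)"
proof -
  have "\<forall>i\<in>I. \<exists>\<D>. countable \<D> \<and> (\<forall>D\<in>\<D>. closed D \<and> interior D = {}) \<and> N i \<subseteq> \<Union>\<D>"
    using assms(2) by (simp add: meagre_def)
  from bchoice[OF this] obtain \<D>
    where D: "\<forall>i\<in>I. countable (\<D> i) \<and> (\<forall>D\<in>\<D> i. closed D \<and> interior D = {}) \<and> N i \<subseteq> \<Union>(\<D> i)" ..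
  show ?thesis
    unfolding meagre_def
  proof (intro exI conjI)
    show "countable (\<Union>i\<in>I. \<D> i)"
      using D assms(1) by blast
    show "\<forall>D\<in>\<Union>i\<in>I. \<D> i. closed D \<and> interior D = {}"
      using D by auto
    show "(\<Union>i\<in>I. N i) \<subseteq> \<Union>(\<Union>i\<in>I. \<D> i)"
      using D by (intro UN_least) (meson UN_upper Union_mono subset_trans)
  qed
qed

lemma meagre_Un: "meagre M \<Longrightarrow> meagre N \<Longrightarrow> meagre (M \<union> N)"
  using meagre_UN[of "{True, False}" "\<lambda>b. if b then M else N"] 
  by (simp add: Un_commute split: if_splits)

text \<open>An open subset of \<open>closure S - S\<close> is disjoint from \<open>S\<close>, hence
  also from \<open>closure S\<close>, which contains it.\<close>

lemma meagre_frontier_open: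
  assumes "open S"
  shows "meagre (closure S - S)"
proof (rule meagre_nowhere_dense)
  show "closed (closure S - S)"
    using assms by (simp add: closed_Diff)
  have "interior (closure S - S) \<inter> closure S = {}"
    using interior_subset[of "closure S - S"] by (subst open_Int_closure_eq_empty) auto
  then show "interior (closure S - S) = {}"
    using interior_subset by blast
qed

lemma Hausdorff_space_euclidean_t2: "Hausdorff_space (euclidean :: 'a::t2_space topology)"
  unfolding Hausdorff_space_def disjnt_def using hausdorff by (metis open_openin)

lemma Hausdorff_cantor: "Hausdorff_space (euclidean :: (nat \<Rightarrow> bool) topology)"
  unfolding euclidean_product_topology[symmetric] Hausdorff_space_product_topology
  by (simp add: Hausdorff_space_euclidean_t2)

lemma compact_cantor: "compact_space (euclidean :: (nat \<Rightarrow> bool) topology)"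
proof -
  have "compact_space (euclidean :: bool topology)"
    by (simp add: compact_space_def finite_imp_compact)
  then show ?thesis
    unfolding euclidean_product_topology[symmetric] compact_space_product_topology by simp
qed

lemma compact_imp_closed_cantor:
  fixes S :: "(nat \<Rightarrow> bool) set"
  shows "compact S \<Longrightarrow> closed S"
  using compactin_imp_closedin[OF Hausdorff_cantor, of S] by simp

text \<open>The Baire category theorem for locally compact regular spaces applies, as the Cantor
  space is compact and Hausdorff.\<close>

lemma Baire_cantor:
  fixes S :: "(nat \<Rightarrow> bool) set"
  assumes "meagre S" "open S"
  shows "S = {}"
proof -
  obtain \<D> where D: "countable \<D>" "\<And>D. D \<in> \<D> \<Longrightarrow> closed D \<and> interior D = {}" "S \<subseteq> \<Union>\<D>"
    using assms unfolding meagre_def by auto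
  have "euclidean interior_of \<Union>\<D> = {}"
  proof (rule Baire_category_alt[OF _ D(1)])
    show "completely_metrizable_space (euclidean :: (nat \<Rightarrow> bool) topology) \<or>
          locally_compact_space (euclidean :: (nat \<Rightarrow> bool) topology) \<and> regular_space (euclidean :: (nat \<Rightarrow> bool) topology)"
      using compact_cantor Hausdorff_cantor
      by (simp add: compact_imp_locally_compact_space compact_Hausdorff_imp_regular_space)
  qed (use D(2) in auto)
  then show ?thesis
    using interior_maximal[OF D(3) assms(2)] by simp
qed

section \<open>Flips of coordinates and a set without the Baire property\<close>

text \<open>This is translation by the indicator of \<open>F\<close> when the Cantor space is viewed
  as a countable power of Z/2. Each such map is an involutive homeomorphism, so it preserves
  category.\<close>

definition flip :: "nat set \<Rightarrow> (nat \<Rightarrow> bool) \<Rightarrow> nat \<Rightarrow> bool"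
  where "flip F \<alpha> = (\<lambda>n. \<alpha> n \<noteq> (n \<in> F))"

lemma flip_flip [simp]: "flip F (flip F \<alpha>) = \<alpha>"
  by (auto simp: flip_def)

lemma flip_image_eq_vimage: "flip F ` S = flip F -` S"
  by (auto intro: rev_image_eqI)

lemma continuous_on_flip: "continuous_on UNIV (flip F)"
  unfolding flip_def
  by (intro continuous_on_coordinatewise_then_product)
    (rule continuous_on_compose2[OF Topological_Spaces.continuous_on_discrete continuous_on_product_coordinates subset_UNIV])

lemma open_flip: "open S \<Longrightarrow> open (flip F ` S)"
  by (simp add: flip_image_eq_vimage continuous_on_flip open_vimage)

lemma closed_flip: "closed S \<Longrightarrow> closed (flip F ` S)"
  by (simp add: flip_image_eq_vimage continuous_on_flip closed_vimage)

lemma meagre_flip: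
  assumes "meagre N"
  shows "meagre (flip F ` N)"
proof -
  obtain \<D> where D: "countable \<D>" "\<And>D. D \<in> \<D> \<Longrightarrow> closed D \<and> interior D = {}" "N \<subseteq> \<Union>\<D>"
    using assms unfolding meagre_def by auto
  have "interior (flip F ` D) = {}" if "D \<in> \<D>" for D
  proof -
    have "flip F ` interior (flip F ` D) \<subseteq> D"
      using interior_subset by force
    then show ?thesis
      using open_flip[OF open_interior] D(2)[OF that] interior_maximal by blast
  qed
  then show ?thesis
    unfolding meagre_def
    by (intro exI[of _ "(`) (flip F) ` \<D>"])
      (use D closed_flip in \<open>auto simp flip: image_Union\<close>)
qed

definition baire_property :: "'a::topological_space set \<Rightarrow> bool"
  where "baire_property A \<longleftrightarrow> (\<exists>S. open S \<and> meagre (sym_diff A S))"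

text \<open>A basic open box restricts only finitely many coordinates, and flipping an unrestricted
  one stays inside the box.\<close>

lemma ex_flip_mem_open:
  assumes "open S" "\<alpha> \<in> S"
  shows "\<exists>n. flip {n} \<alpha> \<in> S"
proof -
  have "openin (product_topology (\<lambda>i. euclidean) UNIV) S"
    using assms by (simp add: euclidean_product_topology)
  from product_topology_open_contains_basis[OF this assms(2)] obtain X
    where X: "\<alpha> \<in> Pi\<^sub>E UNIV X" "finite {i. X i \<noteq> UNIV}" "Pi\<^sub>E UNIV X \<subseteq> S"
    by auto
  then obtain n where n: "X n = UNIV"
    using ex_new_if_finite[of "{i. X i \<noteq> UNIV}"] by auto
  have "flip {n} \<alpha> i \<in> X i" for i
    using X(1) n by (cases "i = n") (auto simp: flip_def PiE_iff)
  then have "flip {n} \<alpha> \<in> Pi\<^sub>E UNIV X"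
    by (simp add: PiE_iff)
  then show ?thesis
    using X(3) by blast
qed

text \<open>The witness is Vitali's: a selector for the orbits of the group of finite flips.\<close>

lemma ex_not_baire_property: "\<exists>A :: (nat \<Rightarrow> bool) set. \<not> baire_property A"
proof (rule ccontr)
  assume all: "\<not> ?thesis"
  define rep where "rep \<alpha> = (SOME \<beta>. \<exists>F. finite F \<and> \<beta> = flip F \<alpha>)" for \<alpha>
  have rep: "\<exists>F. finite F \<and> rep \<alpha> = flip F \<alpha>" for \<alpha>
    unfolding rep_def by (rule someI[of _ \<alpha>]) (auto simp: flip_def intro: exI[of _ "{}"])
  \<comment> \<open>Both points have the same orbit under finite flips, so \<open>SOME\<close>
    chooses from the same predicate.\<close>
  have rep_flip: "rep (flip {n} \<alpha>) = rep \<alpha>" for n \<alpha>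
  proof -
    have "(\<exists>F. finite F \<and> \<beta> = flip F (flip {n} \<alpha>)) \<longleftrightarrow> (\<exists>F. finite F \<and> \<beta> = flip F \<alpha>)" for \<beta>
    proof -
      have "flip F (flip {n} \<alpha>) = flip (sym_diff F {n}) \<alpha>"
        "flip F \<alpha> = flip (sym_diff F {n}) (flip {n} \<alpha>)" for F
        by (auto simp: flip_def fun_eq_iff)
      moreover have "finite (sym_diff F {n})" if "finite F" for F
        using that by auto
      ultimately show ?thesis
        by metis
    qed
    then show ?thesis
      unfolding rep_def by simp
  qed
  define V where "V = range rep"
  obtain S where S: "open S" "meagre (sym_diff V S)"
    using all unfolding baire_property_def by blast
  show False
  proof (cases "S = {}")
    case True
    \<comment> \<open>Here \<open>V\<close> itself is meagre, and its translates by the countably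
      many finite flips cover the space.\<close>
    have "UNIV = (\<Union>F\<in>Collect finite. flip F ` V)"
    proof -
      have "\<exists>F. finite F \<and> \<alpha> \<in> flip F ` V" for \<alpha>
        using rep[of \<alpha>] unfolding V_def by (metis flip_flip image_eqI rangeI)
      then show ?thesis
        by blast
    qed
    moreover have "countable (Collect (finite :: nat set \<Rightarrow> bool))"
      by (rule countable_Collect_finite)
    ultimately have "meagre (UNIV :: (nat \<Rightarrow> bool) set)"
      using S True meagre_UN[of "Collect finite" "\<lambda>F. flip F ` V"] meagre_flip by simp
    then show False
      using Baire_cantor by fastforce
  next
    case False
    then obtain \<alpha> n where n: "\<alpha> \<in> S" "flip {n} \<alpha> \<in> S"
      using ex_flip_mem_open[OF S(1)] by blast
    \<comment> \<open>\<open>V\<close> contains one point of each orbit, while flipping coordinate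
      \<open>n\<close> moves a point to a different point of its orbit.\<close>
    have "V \<inter> flip {n} ` V = {}"
    proof -
      have False if "rep \<beta> = flip {n} (rep \<gamma>)" for \<beta> \<gamma>
      proof -
        have idem: "rep (rep \<delta>) = rep \<delta>" for \<delta>
        proof -
          obtain F where "finite F" "rep \<delta> = flip F \<delta>"
            using rep by blast
          moreover have "rep (flip F \<delta>) = rep \<delta>" if "finite F" for F
            using that
          proof (induction F)
            case (insert m F)
            then have "flip (insert m F) \<delta> = flip {m} (flip F \<delta>)"
              by (auto simp: flip_def fun_eq_iff)
            then show ?case
              using insert rep_flip by simp
          qed (simp add: flip_def)
          ultimately show ?thesis
            by simp
        qed
        then have "rep \<beta> = rep \<gamma>"
          using that rep_flip by metis
        then have "rep \<gamma> n = flip {n} (rep \<gamma>) n"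
          using that by metis
        then show False
          by (simp add: flip_def)
      qed
      then show ?thesis
        unfolding V_def by blast
    qed
    \<comment> \<open>A point of the left side cannot lie in both \<open>V\<close> and its
      translate, so it falls into one of the two meagre differences.\<close>
    then have "S \<inter> flip {n} ` S \<subseteq> sym_diff V S \<union> flip {n} ` sym_diff V S"
      by blast
    then have "meagre (S \<inter> flip {n} ` S)"
      using S meagre_Un meagre_flip meagre_subset by metis
    then have "S \<inter> flip {n} ` S = {}"
      using Baire_cantor S(1) open_flip by blast
    then show False
      using n by (metis IntI empty_iff flip_flip image_eqI)
  qed
qed

subsection \<open>Compact spaces in which every set is Borel\<close>

text \<open>By Zorn there is a maximal open set whose removal from \<open>L\<close> keeps the map
  onto. The remainder is \<open>M\<close>: removing a further open set that meets \<open>M\<close>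
  would contradict maximality.\<close>

lemma irreducible_restriction:
  fixes g :: "'k::t2_space \<Rightarrow> nat \<Rightarrow> bool"
  assumes L: "compact L" and g: "continuous_on L g" and onto: "g ` L = UNIV"
  obtains M where "compact M" "M \<subseteq> L" "g ` M = UNIV"
    "\<And>U. open U \<Longrightarrow> U \<inter> M \<noteq> {} \<Longrightarrow> g ` (M - U) \<noteq> UNIV"
proof -
  define \<A> where "\<A> = {U. open U \<and> g ` (L - U) = UNIV}"
  have "\<exists>V\<in>\<A>. \<forall>X\<in>\<A>. V \<subseteq> X \<longrightarrow> X = V"
  proof (rule subset_Zorn_nonempty)
    have "{} \<in> \<A>"
      using onto by (simp add: \<A>_def)
    then show "\<A> \<noteq> {}"
      by blast
  next
    fix \<C> assume C: "\<C> \<noteq> {}" "subset.chain \<A> \<C>"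
    then have CA: "\<C> \<subseteq> \<A>"
      by (simp add: subset.chain_def)
    have "\<alpha> \<in> g ` (L - \<Union>\<C>)" for \<alpha>
    proof -
      have "closed {\<alpha>}"
        by (rule compact_imp_closed_cantor) simp
      then obtain T where T: "closed T" "T \<inter> L = g -` {\<alpha>} \<inter> L"
        using g unfolding continuous_on_closed_invariant by blast
      \<comment> \<open>\<open>T \<inter> L\<close> is the fibre over \<open>\<alpha>\<close> and is
        compact. By the finite intersection property some point of it survives the removal of the
        whole chain.\<close>
      have "(T \<inter> L) \<inter> (\<Inter>U\<in>\<C>. - U) \<noteq> {}"
      proof (rule compact_imp_fip_image)
        show "compact (T \<inter> L)"
          using T(1) L by (rule closed_Int_compact)
        show "closed (- U)" if "U \<in> \<C>" for U
          using that CA by (auto simp: \<A>_def closed_Compl)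
      next
        fix I assume I: "finite I" "I \<subseteq> \<C>"
        \<comment> \<open>A nonempty finite part of a chain contains its own union; the empty part
          removes nothing.\<close>
        have "\<Union>I \<in> \<A>"
        proof (cases "I = {}")
          case True
          then show ?thesis
            using onto by (simp add: \<A>_def)
        next
          case False
          have "\<Union>I \<in> I"
          proof (rule finite_Sup_in[OF I(1) False])
            fix X Y assume "X \<in> I" "Y \<in> I"
            then have "X \<subseteq> Y \<or> Y \<subseteq> X"
              using C(2) I(2) by (meson subset_chain_def subsetD)
            then show "sup X Y \<in> I"
              using \<open>X \<in> I\<close> \<open>Y \<in> I\<close> by (auto simp: sup_absorb1 sup_absorb2)
          qed
          then show ?thesis
            using I(2) CA by blast
        qed
        then have "\<alpha> \<in> g ` (L - \<Union>I)"
          by (simp add: \<A>_def)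
        then obtain x where "x \<in> L - \<Union>I" "g x = \<alpha>"
          by blast
        then show "(T \<inter> L) \<inter> (\<Inter>U\<in>I. - U) \<noteq> {}"
          using T(2) by blast
      qed
      then obtain x where "x \<in> L" "g x = \<alpha>" "x \<notin> \<Union>\<C>"
        using T(2) by blast
      then show ?thesis
        by blast
    qed
    moreover have "open (\<Union>\<C>)"
      using CA by (auto simp: \<A>_def)
    ultimately show "\<Union>\<C> \<in> \<A>"
      by (auto simp: \<A>_def)
  qed
  then obtain V where V: "open V" "g ` (L - V) = UNIV"
    and max: "\<And>X. open X \<Longrightarrow> g ` (L - X) = UNIV \<Longrightarrow> V \<subseteq> X \<Longrightarrow> X = V"
    by (auto simp: \<A>_def)
  show ?thesis
  proof (rule that[of "L - V"])
    show "compact (L - V)"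
      using L V(1) by (rule compact_diff)
    show "g ` (L - V - U) \<noteq> UNIV" if "open U" "U \<inter> (L - V) \<noteq> {}" for U
      using max[of "V \<union> U"] that V(1) by (auto simp: Diff_eq Int_assoc open_Un)
  qed (use V in auto)
qed

lemma Bo_euclidean: "Bo euclidean = sigma_sets UNIV {U. open U}"
  by (simp add: Bo_def)

text \<open>
  Modulo a meagre set of fibres, every Borel set of \<open>M\<close> is a union of whole fibres of the irreducible
  map \<open>g\<close>, namely of those over some open subset of the Cantor space.
\<close>

lemma baire_property_of_surjection:
  fixes g :: "'k::t2_space \<Rightarrow> nat \<Rightarrow> bool"
  assumes Bo: "Bo (euclidean :: 'k topology) = Pow UNIV"
    and L: "compact L" and gL: "continuous_on L g" "g ` L = UNIV"
  shows "baire_property (A :: (nat \<Rightarrow> bool) set)"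
proof -
  obtain M where M: "compact M" "M \<subseteq> L" "g ` M = UNIV"
    and irr: "\<And>U. open U \<Longrightarrow> U \<inter> M \<noteq> {} \<Longrightarrow> g ` (M - U) \<noteq> UNIV"
    using irreducible_restriction[OF L gL] by blast
  have g: "continuous_on M g"
    using gL(1) M(2) continuous_on_subset by blast
  define fib where "fib \<alpha> = {x\<in>M. g x = \<alpha>}" for \<alpha>
  have fib_nonempty: "fib \<alpha> \<noteq> {}" for \<alpha>
  proof -
    have "\<alpha> \<in> g ` M"
      using M(3) by simp
    then show ?thesis
      by (auto simp: fib_def)
  qed
  \<comment> \<open>The exceptional points: over \<open>S\<close> a fibre ought to lie inside
    \<open>B\<close>, and off \<open>S\<close> it ought to miss \<open>B\<close>.\<close>
  define bad where "bad B S = {\<alpha>\<in>S. fib \<alpha> - B \<noteq> {}} \<union> {\<alpha>. \<alpha> \<notin> S \<and> fib \<alpha> \<inter> B \<noteq> {}}" for B S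
  have "\<exists>S. open S \<and> meagre (bad B S)" if "B \<in> sigma_sets UNIV {U. open U}" for B
    using that
  proof induction
    case (Basic U)
    then have U: "open U"
      by simp
    define S where "S = {\<alpha>. fib \<alpha> \<subseteq> U}"
    have "S = - g ` (M - U)"
      by (auto simp: S_def fib_def)
    moreover have "compact (g ` (M - U))"
      using g M(1) U by (meson Diff_subset compact_continuous_image compact_diff continuous_on_subset)
    ultimately have "open S"
      using compact_imp_closed_cantor open_Compl by metis
    have "bad U S \<subseteq> closure S - S"
    proof
      fix \<alpha> assume "\<alpha> \<in> bad U S"
      then obtain x where x: "\<alpha> \<notin> S" "x \<in> U" "x \<in> M" "g x = \<alpha>"
        by (auto simp: bad_def S_def fib_def)
      \<comment> \<open>Otherwise irreducibility, applied to \<open>U \<inter> V\<close>, gives a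
        point \<open>\<beta>\<close> whose whole fibre lies in \<open>U \<inter> V\<close>. Lying in
        \<open>U\<close> puts \<open>\<beta>\<close> into \<open>S\<close>, yet \<open>V\<close>
        sits over the complement of \<open>closure S\<close>.\<close>
      have "\<alpha> \<in> closure S"
      proof (rule ccontr)
        assume "\<alpha> \<notin> closure S"
        obtain V where V: "open V" "V \<inter> M = g -` (- closure S) \<inter> M"
          using g unfolding continuous_on_open_invariant by (metis closed_closure open_Compl)
        then have "x \<in> (U \<inter> V) \<inter> M"
          using x \<open>\<alpha> \<notin> closure S\<close> by blast
        then obtain \<beta> where \<beta>: "\<beta> \<notin> g ` (M - (U \<inter> V))"
          using irr[of "U \<inter> V"] U V(1) by blast
        then have "fib \<beta> \<subseteq> U \<inter> V"
          by (auto simp: fib_def)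
        then have "\<beta> \<in> S"
          by (auto simp: S_def)
        obtain y where "y \<in> fib \<beta>"
          using fib_nonempty by blast
        then have "y \<in> V \<inter> M" "g y = \<beta>"
          using \<open>fib \<beta> \<subseteq> U \<inter> V\<close> by (auto simp: fib_def)
        then show False
          using V(2) \<open>\<beta> \<in> S\<close> closure_subset by blast
      qed
      then show "\<alpha> \<in> closure S - S"
        using x by simp
    qed
    then show ?case
      using \<open>open S\<close> meagre_frontier_open meagre_subset by blast
  next
    case Empty
    have "bad {} {} = {}"
      by (simp add: bad_def)
    then show ?case
      using meagre_nowhere_dense[of "{}"] by (intro exI[of _ "{}"]) simp
  next
    case (Compl B)
    then obtain S where S: "open S" "meagre (bad B S)"
      by blast
    \<comment> \<open>Complementation exchanges inside and outside; replacing \<open>- S\<close> by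
      the open set \<open>- closure S\<close> costs only the boundary of \<open>S\<close>.\<close>
    have "bad (UNIV - B) (- closure S) \<subseteq> bad B S \<union> (closure S - S)"
      using closure_subset[of S] unfolding bad_def by blast
    then have "meagre (bad (UNIV - B) (- closure S))"
      using S meagre_Un meagre_frontier_open meagre_subset by metis
    then show ?case
      by (intro exI[of _ "- closure S"]) (simp add: open_Compl)
  next
    case (Union B)
    then have "\<forall>i. \<exists>S. open S \<and> meagre (bad (B i) S)"
      by blast
    from choice[OF this] obtain S where S: "\<And>i::nat. open (S i)" "\<And>i. meagre (bad (B i) (S i))"
      by blast
    have "bad (\<Union>i. B i) (\<Union>i. S i) \<subseteq> (\<Union>i. bad (B i) (S i))"
      unfolding bad_def by blast
    moreover have "meagre (\<Union>i. bad (B i) (S i))"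
      by (rule meagre_UN) (use S(2) in auto)
    ultimately show ?case
      using S(1) meagre_subset by blast
  qed
  moreover have "g -` A \<in> sigma_sets UNIV {U. open U}"
    using Bo unfolding Bo_euclidean by simp
  ultimately obtain S where S: "open S" "meagre (bad (g -` A) S)"
    by blast
  \<comment> \<open>The preimage of \<open>A\<close> is a union of whole fibres, all nonempty, so
    any disagreement between \<open>A\<close> and \<open>S\<close> makes a fibre
    exceptional.\<close>
  have "sym_diff A S \<subseteq> bad (g -` A) S"
  proof
    fix \<alpha> assume "\<alpha> \<in> sym_diff A S"
    moreover obtain x where "x \<in> fib \<alpha>" "g x = \<alpha>"
      using fib_nonempty[of \<alpha>] by (auto simp: fib_def)
    ultimately show "\<alpha> \<in> bad (g -` A) S"
      unfolding bad_def by blast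
  qed
  then show ?thesis
    unfolding baire_property_def using S meagre_subset by blast
qed

section \<open>Sets without isolated points and maps onto the Cantor space\<close>

lemma regular_compact_t2:
  fixes x :: "'k::t2_space"
  assumes "compact (UNIV :: 'k set)" "open U" "x \<in> U"
  obtains V where "open V" "x \<in> V" "closure V \<subseteq> U"
proof -
  have "regular_space (euclidean :: 'k topology)"
    using assms(1) by (intro compact_Hausdorff_imp_regular_space Hausdorff_space_euclidean_t2)
      (simp add: compact_space_def)
  then obtain V W where "open V" "open W" "x \<in> V" "- U \<subseteq> W" "disjnt V W"
    using assms(2,3) unfolding regular_space_def
    by (metis ComplD Compl_eq_Diff_UNIV DiffI UNIV_I closed_Compl closed_closedin open_openin topspace_euclidean)
  then have "closure V \<subseteq> - W"
    by (intro closure_minimal) (auto simp: disjnt_def)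
  then show ?thesis
    using that \<open>open V\<close> \<open>x \<in> V\<close> \<open>- U \<subseteq> W\<close> by blast
qed

text \<open>This is a Cantor scheme. As \<open>S\<close> has no isolated point, every open set
  meeting \<open>S\<close> contains the closures of two open sets that meet \<open>S\<close>, and
  these closures are disjoint. Iteration gives a binary tree, and compactness provides a point of
  \<open>S\<close> along every branch.\<close>

lemma independent_closed_sets:
  fixes S :: "'k::t2_space set"
  assumes K: "compact (UNIV :: 'k set)" and S: "closed S" "S \<noteq> {}"
    and lim: "\<And>x. x \<in> S \<Longrightarrow> x islimpt S"
  obtains A :: "nat \<Rightarrow> bool \<Rightarrow> 'k set"
  where "\<And>n b. closed (A n b)" "\<And>n. A n True \<inter> A n False = {}"
    "\<And>\<alpha>. S \<inter> (\<Inter>n. A n (\<alpha> n)) \<noteq> {}"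
proof -
  have "\<forall>U. \<exists>V :: bool \<Rightarrow> 'k set. open U \<and> U \<inter> S \<noteq> {} \<longrightarrow>
          (\<forall>b. open (V b) \<and> V b \<inter> S \<noteq> {} \<and> closure (V b) \<subseteq> U) \<and> closure (V True) \<inter> closure (V False) = {}"
  proof (intro allI)
    fix U
    show "\<exists>V :: bool \<Rightarrow> 'k set. open U \<and> U \<inter> S \<noteq> {} \<longrightarrow>
          (\<forall>b. open (V b) \<and> V b \<inter> S \<noteq> {} \<and> closure (V b) \<subseteq> U) \<and> closure (V True) \<inter> closure (V False) = {}"
    proof (cases "open U \<and> U \<inter> S \<noteq> {}")
      case True
      then obtain x where x: "x \<in> U" "x \<in> S"
        by blast
      then obtain y where y: "y \<in> S" "y \<in> U" "y \<noteq> x"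
        using lim[OF x(2)] True unfolding islimpt_def by metis
      then obtain P Q where PQ: "open P" "open Q" "x \<in> P" "y \<in> Q" "P \<inter> Q = {}"
        using hausdorff by metis
      obtain V where V: "open V" "x \<in> V" "closure V \<subseteq> U \<inter> P"
        using regular_compact_t2[OF K, of "U \<inter> P" x] x PQ True by (metis IntI open_Int)
      obtain W where W: "open W" "y \<in> W" "closure W \<subseteq> U \<inter> Q"
        using regular_compact_t2[OF K, of "U \<inter> Q" y] y PQ True by (metis IntI open_Int)
      show ?thesis
        by (rule exI[of _ "\<lambda>b. if b then V else W"]) (use V W x y PQ in auto)
    qed blast
  qed
  from choice[OF this] obtain F :: "'k set \<Rightarrow> bool \<Rightarrow> 'k set" where
    *: "\<forall>U. open U \<and> U \<inter> S \<noteq> {} \<longrightarrow>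
      (\<forall>b. open (F U b) \<and> F U b \<inter> S \<noteq> {} \<and> closure (F U b) \<subseteq> U) \<and>
      closure (F U True) \<inter> closure (F U False) = {}" ..
  have F: "open (F U b) \<and> F U b \<inter> S \<noteq> {}" "closure (F U b) \<subseteq> U"
      "closure (F U True) \<inter> closure (F U False) = {}"
    if "open U \<and> U \<inter> S \<noteq> {}" for U b
    using *[rule_format, OF that] by simp_all
  \<comment> \<open>The tree of open sets, indexed by bit lists with the newest bit at the
    head.\<close>
  define T where "T s = foldr (\<lambda>b U. F U b) s UNIV" for s
  have T_Cons: "T (b # s) = F (T s) b" for b s
    by (simp add: T_def)
  have T: "open (T s) \<and> T s \<inter> S \<noteq> {}" for s
  proof (induction s)
    case Nil
    then show ?case
      using S(2) by (simp add: T_def)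
  qed (simp add: T_Cons F(1))
  have T_sub: "closure (T (b # s)) \<subseteq> T s" for b s
    unfolding T_Cons using T by (rule F(2))
  have T_disj: "closure (T s) \<inter> closure (T t) = {}" if "length s = length t" "s \<noteq> t" for s t
    using that
  proof (induction s t rule: list_induct2)
    case (Cons b s c t)
    show ?case
    proof (cases "s = t")
      case True
      then show ?thesis
        using F(3)[OF T[of s]] Cons.prems by (cases b; cases c) (simp_all add: T_Cons Int_commute)
    next
      case False
      then show ?thesis
        using Cons.IH T_sub[of b s] T_sub[of c t] closure_subset[of "T s"] closure_subset[of "T t"] by blast
    qed
  qed simp
  \<comment> \<open>\<open>A n b\<close> collects all nodes whose bit number \<open>n\<close>,
    counted from 0, is \<open>b\<close>, whatever the earlier bits are.\<close>
  define A where "A n b = (\<Union>s\<in>{s. length s = n}. closure (T (b # s)))" for n b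
  show ?thesis
  proof
    have "finite {s :: bool list. length s = n}" for n
      using finite_lists_length_eq[of "UNIV :: bool set"] by simp
    then show "closed (A n b)" for n b
      unfolding A_def by (intro closed_UN) auto
    show "A n True \<inter> A n False = {}" for n
    proof -
      have "closure (T (True # s)) \<inter> closure (T (False # t)) = {}" if "length s = n" "length t = n" for s t
        using that by (intro T_disj) auto
      then show ?thesis
        unfolding A_def by blast
    qed
  next
    fix \<alpha> :: "nat \<Rightarrow> bool"
    \<comment> \<open>The first \<open>n\<close> bits of \<open>\<alpha>\<close>, reversed to fit
      the newest-first order of \<open>T\<close>.\<close>
    define s where "s n = map \<alpha> (rev [0..<n])" for n
    have s_Suc: "s (Suc n) = \<alpha> n # s n" for n
      by (simp add: s_def)
    have mono: "T (s n) \<subseteq> T (s m)" if "m \<le> n" for m n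
      using that by (rule lift_Suc_antimono_le[rotated])
        (use T_sub closure_subset s_Suc in \<open>metis subset_trans\<close>)
    have "S \<inter> (\<Inter>n. closure (T (s n))) \<noteq> {}"
    proof (rule compact_imp_fip_image)
      show "compact S"
        using K S(1) closed_Int_compact by fastforce
    next
      fix I :: "nat set" assume "finite I"
      then have "T (s (Max I)) \<subseteq> T (s i)" if "i \<in> I" for i
        using that by (intro mono) simp
      moreover have "T (s i) \<subseteq> closure (T (s i))" for i
        by (rule closure_subset)
      ultimately have "T (s (Max I)) \<inter> S \<subseteq> S \<inter> (\<Inter>n\<in>I. closure (T (s n)))"
        by blast
      then show "S \<inter> (\<Inter>n\<in>I. closure (T (s n))) \<noteq> {}"
        using T by blast
    qed simp
    moreover have "closure (T (s (Suc n))) \<subseteq> A n (\<alpha> n)" for n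
      unfolding A_def s_Suc by (rule UN_upper) (simp add: s_def)
    ultimately show "S \<inter> (\<Inter>n. A n (\<alpha> n)) \<noteq> {}"
      by blast
  qed
qed

text \<open>In a closed set without isolated points there is an independent family of pairs of
  closed sets. Recording which set of each pair contains a point maps a compact set continuously
  onto the Cantor space, and then every subset of the Cantor space would have the Baire
  property.\<close>

lemma scattered_of_Bo_eq_Pow:
  fixes S :: "'k::t2_space set"
  assumes K: "compact (UNIV :: 'k set)" and Bo: "Bo (euclidean :: 'k topology) = Pow UNIV"
    and S: "closed S" "S \<noteq> {}"
  obtains x where "x \<in> S" "\<not> x islimpt S"
proof -
  have False if lim: "\<And>x. x \<in> S \<Longrightarrow> x islimpt S"
  proof (rule independent_closed_sets[OF K S lim])
    fix A :: "nat \<Rightarrow> bool \<Rightarrow> 'k set" assume A: "\<And>n b. closed (A n b)"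
      "\<And>n. A n True \<inter> A n False = {}" "\<And>\<alpha>. S \<inter> (\<Inter>n. A n (\<alpha> n)) \<noteq> {}"
    define L where "L = S \<inter> (\<Inter>n. A n True \<union> A n False)"
    define g where "g x n \<longleftrightarrow> x \<in> A n True" for x n
    have "closed L"
      unfolding L_def by (intro closed_Int closed_INT ballI closed_Un S(1) A(1))
    then have "compact L"
      using closed_Int_compact[OF _ K] by simp
    moreover have "continuous_on L g"
    proof (rule continuous_on_coordinatewise_then_product)
      fix n
      have "\<exists>C. closed C \<and> C \<inter> L = (\<lambda>x. g x n) -` B \<inter> L" for B
      proof (intro exI conjI)
        \<comment> \<open>On \<open>L\<close> exactly one of \<open>A n True\<close> and
          \<open>A n False\<close> contains a given point, so every preimage under coordinate
          \<open>n\<close> is cut out by a union of at most two closed sets.\<close>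
        define C where "C = (if True \<in> B then A n True else {}) \<union> (if False \<in> B then A n False else {})"
        show "closed C"
          by (simp add: C_def A(1) closed_Un)
        have "x \<in> C \<longleftrightarrow> g x n \<in> B" if "x \<in> L" for x
        proof -
          have "x \<in> A n True \<and> x \<notin> A n False \<or> x \<notin> A n True \<and> x \<in> A n False"
            using that A(2)[of n] unfolding L_def by blast
          then show ?thesis
            by (auto simp: C_def g_def)
        qed
        then show "C \<inter> L = (\<lambda>x. g x n) -` B \<inter> L"
          by auto
      qed
      then show "continuous_on L (\<lambda>x. g x n)"
        unfolding continuous_on_closed_invariant by blast
    qed
    moreover have "g ` L = UNIV"
    proof -
      have "\<alpha> \<in> g ` L" for \<alpha>
      proof -
        obtain x where x: "x \<in> S" "\<And>n. x \<in> A n (\<alpha> n)"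
          using A(3)[of \<alpha>] by auto
        have "(x \<in> A n True \<longleftrightarrow> \<alpha> n) \<and> x \<in> A n True \<union> A n False" for n
          using A(2)[of n] x(2)[of n] by (cases "\<alpha> n") auto
        then have "x \<in> L" "g x = \<alpha>"
          using x(1) unfolding L_def g_def fun_eq_iff by blast+
        then show ?thesis
          by blast
      qed
      then show ?thesis
        by blast
    qed
    ultimately show False
      using baire_property_of_surjection[OF Bo] ex_not_baire_property by blast
  qed
  then show ?thesis
    using that by metis
qed

subsection \<open>Point masses of functionals on continuous functions\<close>

lemma ex_bcontfun:
  fixes f :: "'k::t2_space \<Rightarrow> real"
  assumes "compact (UNIV :: 'k set)" "continuous_on UNIV f"
  obtains h :: "'k \<Rightarrow>\<^sub>C real" where "\<And>x. apply_bcontfun h x = f x"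
proof -
  obtain h where "f = apply_bcontfun h"
    by (rule bcontfunE[OF continuous_on_compact_imp_bcontfun[OF assms]])
  then show ?thesis
    using that by simp
qed

lemma abs_apply_bcontfun_le: "\<bar>apply_bcontfun f x\<bar> \<le> norm f"
  using norm_bounded[of f x] by simp

lemma Urysohn_bcontfun:
  fixes S T :: "'k::t2_space set"
  assumes K: "compact (UNIV :: 'k set)" and "closed S" "closed T" "S \<inter> T = {}"
  obtains h :: "'k \<Rightarrow>\<^sub>C real" where "\<And>x. 0 \<le> apply_bcontfun h x" "\<And>x. apply_bcontfun h x \<le> 1"
    "\<And>x. x \<in> S \<Longrightarrow> apply_bcontfun h x = 1" "\<And>x. x \<in> T \<Longrightarrow> apply_bcontfun h x = 0"
proof -
  have "normal_space (euclidean :: 'k topology)"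
    using K Hausdorff_space_euclidean_t2
    by (intro compact_Hausdorff_or_regular_imp_normal_space) (auto simp: compact_space_def)
  then obtain f :: "'k \<Rightarrow> real" where f: "continuous_map euclidean (top_of_set {0..1}) f" "f ` T \<subseteq> {0}" "f ` S \<subseteq> {1}"
    using Urysohn_lemma[of euclidean T S 0 1] assms by (auto simp: disjnt_def Int_commute)
  then have "continuous_on UNIV f" "\<And>x. f x \<in> {0..1}"
    by (auto simp: continuous_map_in_subtopology)
  then obtain h where "\<And>x. apply_bcontfun h x = f x"
    using ex_bcontfun[OF K] by metis
  then show ?thesis
    using f \<open>\<And>x. f x \<in> {0..1}\<close> by (intro that[of h]) auto
qed

section \<open>Bump functions and the mass of a functional at a point\<close>

text \<open>The value 1 is required near \<open>x\<close>, not merely at \<open>x\<close>, so that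
  the difference of two bumps vanishes on a neighbourhood of \<open>x\<close>.\<close>

definition bumps :: "'k::topological_space set \<Rightarrow> 'k \<Rightarrow> ('k \<Rightarrow>\<^sub>C real) set"
  where "bumps U x = {f. (\<forall>y. 0 \<le> apply_bcontfun f y \<and> apply_bcontfun f y \<le> 1) \<and>
    (\<forall>y. y \<notin> U \<longrightarrow> apply_bcontfun f y = 0) \<and>
    (\<exists>V. open V \<and> x \<in> V \<and> (\<forall>y\<in>V. apply_bcontfun f y = 1))}"

text \<open>Limits along this filter are limits as the supports shrink to \<open>x\<close>. A filter
  is used because \<open>x\<close> need not have a countable neighbourhood base.\<close>

definition bump_filter :: "'k::topological_space \<Rightarrow> ('k \<Rightarrow>\<^sub>C real) filter"
  where "bump_filter x = (INF U\<in>{U. open U \<and> x \<in> U}. principal (bumps U x))"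

lemma eventually_bump_filter:
  "eventually P (bump_filter x) \<longleftrightarrow> (\<exists>U. open U \<and> x \<in> U \<and> (\<forall>f\<in>bumps U x. P f))"
proof -
  have "\<exists>W\<in>{U. open U \<and> x \<in> U}. principal (bumps W x) \<le> inf (principal (bumps U x)) (principal (bumps V x))"
    if "U \<in> {U. open U \<and> x \<in> U}" "V \<in> {U. open U \<and> x \<in> U}" for U V
    using that by (intro bexI[of _ "U \<inter> V"]) (auto simp: bumps_def)
  then show ?thesis
    unfolding bump_filter_def by (subst eventually_INF_base) (auto simp: eventually_principal)
qed

lemma norm_bump_le: "f \<in> bumps U x \<Longrightarrow> norm f \<le> 1"
  by (rule norm_bound) (simp add: bumps_def)

lemma bump_filter_not_bot:
  fixes x :: "'k::t2_space"
  assumes K: "compact (UNIV :: 'k set)"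
  shows "bump_filter x \<noteq> bot"
proof -
  have "bumps U x \<noteq> {}" if U: "open U" "x \<in> U" for U
  proof -
    obtain V where V: "open V" "x \<in> V" "closure V \<subseteq> U"
      using regular_compact_t2[OF K U] by blast
    obtain h :: "'k \<Rightarrow>\<^sub>C real" where h: "\<And>x. 0 \<le> apply_bcontfun h x" "\<And>x. apply_bcontfun h x \<le> 1"
      "\<And>x. x \<in> closure V \<Longrightarrow> apply_bcontfun h x = 1" "\<And>x. x \<in> - U \<Longrightarrow> apply_bcontfun h x = 0"
      by (rule Urysohn_bcontfun[OF K, of "closure V" "- U"]) (use V U in auto)
    have "\<forall>y\<in>V. apply_bcontfun h y = 1"
      using h(3) closure_subset by blast
    then have "h \<in> bumps U x"
      using V(1,2) h(1,2,4) by (auto simp: bumps_def)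
    then show ?thesis
      by blast
  qed
  then show ?thesis
    unfolding trivial_limit_def eventually_bump_filter by (metis ex_in_conv)
qed

text \<open>
  Otherwise one finds \<open>n\<close> functions in the unit ball with disjoint supports on each of which \<open>\<phi>\<close> is at
  least \<open>e\<close>; their sum is in the unit ball as well, so that \<open>n * e \<le> norm \<phi>\<close>.
\<close>

lemma small_on_punctured_neighbourhood:
  fixes \<phi> :: "('k::topological_space \<Rightarrow>\<^sub>C real) dual"
  assumes "e > 0"
  obtains U where "open U" "x \<in> U"
    "\<And>h V. \<lbrakk>\<And>y. y \<notin> U \<Longrightarrow> apply_bcontfun h y = 0; open V; x \<in> V;
      \<And>y. y \<in> V \<Longrightarrow> apply_bcontfun h y = 0; norm h \<le> 1\<rbrakk> \<Longrightarrow> \<bar>blinfun_apply \<phi> h\<bar> \<le> e"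
proof (rule ccontr)
  note good = that
  define adm where "adm U h \<longleftrightarrow> (\<forall>y. y \<notin> U \<longrightarrow> apply_bcontfun h y = 0) \<and>
    (\<exists>V. open V \<and> x \<in> V \<and> (\<forall>y\<in>V. apply_bcontfun h y = 0)) \<and> (\<forall>y. \<bar>apply_bcontfun h y\<bar> \<le> 1)"
    for U and h :: "'k \<Rightarrow>\<^sub>C real"
  assume neg: "\<not> thesis"
  \<comment> \<open>Passing to \<open>- h\<close> if necessary makes the value positive, so that
    values add up without cancellation.\<close>
  have large: "\<exists>h. adm U h \<and> blinfun_apply \<phi> h > e" if U: "open U" "x \<in> U" for U
  proof -
    obtain h V where h: "\<And>y. y \<notin> U \<Longrightarrow> apply_bcontfun h y = 0" "open V" "x \<in> V"
      "\<And>y. y \<in> V \<Longrightarrow> apply_bcontfun h y = 0" "norm h \<le> 1" "\<bar>blinfun_apply \<phi> h\<bar> > e"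
      using neg good[OF U] by (meson not_le)
    have "\<bar>apply_bcontfun h y\<bar> \<le> 1" for y
      using norm_bounded[of h y] h(5) by simp
    then have "adm U h" "adm U (- h)"
      using h unfolding adm_def by auto
    moreover have "blinfun_apply \<phi> (- h) = - blinfun_apply \<phi> h"
      by (simp add: blinfun.minus_right)
    ultimately show ?thesis
      using h(6) by (cases "blinfun_apply \<phi> h \<ge> 0") (force, fastforce)
  qed
  have many: "\<exists>h. adm U h \<and> blinfun_apply \<phi> h \<ge> real n * e" if "open U" "x \<in> U" for U n
    using that
  proof (induction n arbitrary: U)
    case 0
    then have "adm U 0"
      by (auto simp: adm_def)
    then show ?case
      by (intro exI[of _ 0]) (simp add: blinfun.zero_right)
  next
    case (Suc n)
    obtain h where h: "adm U h" "blinfun_apply \<phi> h > e"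
      using large Suc.prems by blast
    then obtain V where V: "open V" "x \<in> V" "\<forall>y\<in>V. apply_bcontfun h y = 0"
      by (auto simp: adm_def)
    \<comment> \<open>The next function lives inside the neighbourhood \<open>V\<close> on which
      \<open>h\<close> vanishes, so at each point at most one of the two is nonzero.\<close>
    obtain k where k: "adm (U \<inter> V) k" "blinfun_apply \<phi> k \<ge> real n * e"
      using Suc.IH[of "U \<inter> V"] Suc.prems V by blast
    then obtain W where W: "open W" "x \<in> W" "\<forall>y\<in>W. apply_bcontfun k y = 0"
      by (auto simp: adm_def)
    have "\<bar>apply_bcontfun h y + apply_bcontfun k y\<bar> \<le> 1" for y
      using h(1) k(1) V(3) unfolding adm_def by (cases "y \<in> V") auto
    moreover have "\<exists>V. open V \<and> x \<in> V \<and> (\<forall>y\<in>V. apply_bcontfun h y + apply_bcontfun k y = 0)"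
      by (rule exI[of _ "V \<inter> W"]) (use V W in auto)
    ultimately have "adm U (h + k)"
      using h(1) k(1) unfolding adm_def by auto
    moreover have "blinfun_apply \<phi> (h + k) \<ge> real (Suc n) * e"
      using h(2) k(2) by (simp add: blinfun.add_right algebra_simps)
    ultimately show ?case
      by blast
  qed
  obtain n where n: "real n * e > norm \<phi>"
    using reals_Archimedean3[OF assms] by blast
  obtain h where h: "adm UNIV h" "blinfun_apply \<phi> h \<ge> real n * e"
    using many[of UNIV n] by auto
  have "norm h \<le> 1"
    by (rule norm_bound) (use h(1) in \<open>simp add: adm_def\<close>)
  then have "norm (blinfun_apply \<phi> h) \<le> norm \<phi>"
    using norm_blinfun[of \<phi> h] mult_left_le[of "norm h" "norm \<phi>"] by simp
  then show False
    using h(2) n by simp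
qed

text \<open>If \<open>\<phi>\<close> is integration against a regular signed measure, this is the
  measure of the singleton of \<open>x\<close>. Taking a limit over bumps avoids any representing
  measure.\<close>

definition mass :: "'k::topological_space \<Rightarrow> ('k \<Rightarrow>\<^sub>C real) dual \<Rightarrow> real"
  where "mass x \<phi> = Lim (bump_filter x) (blinfun_apply \<phi>)"

text \<open>The difference of two bumps supported in a small \<open>U\<close> vanishes both near
  \<open>x\<close> and off \<open>U\<close>, and has norm at most 1. On such functions
  \<open>\<phi>\<close> is small, so its values along the filter are Cauchy.\<close>

lemma tendsto_mass:
  fixes x :: "'k::t2_space"
  assumes K: "compact (UNIV :: 'k set)"
  shows "(blinfun_apply \<phi> \<longlongrightarrow> mass x \<phi>) (bump_filter x)"
proof -
  have "cauchy_filter (filtermap (blinfun_apply \<phi>) (bump_filter x))"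
    unfolding cauchy_filter_metric_filtermap
  proof (intro allI impI)
    fix e :: real assume "e > 0"
    then obtain U where U: "open U" "x \<in> U"
      "\<And>h V. \<lbrakk>\<And>y. y \<notin> U \<Longrightarrow> apply_bcontfun h y = 0; open V; x \<in> V;
        \<And>y. y \<in> V \<Longrightarrow> apply_bcontfun h y = 0; norm h \<le> 1\<rbrakk> \<Longrightarrow> \<bar>blinfun_apply \<phi> h\<bar> \<le> e / 2"
      using small_on_punctured_neighbourhood[of "e / 2" x \<phi>] by (metis half_gt_zero)
    have "dist (blinfun_apply \<phi> f) (blinfun_apply \<phi> g) < e" if f: "f \<in> bumps U x" and g: "g \<in> bumps U x" for f g
    proof -
      obtain V W where VW: "open V" "x \<in> V" "\<forall>y\<in>V. apply_bcontfun f y = 1"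
        "open W" "x \<in> W" "\<forall>y\<in>W. apply_bcontfun g y = 1"
        using f g unfolding bumps_def by blast
      have "\<bar>apply_bcontfun f y - apply_bcontfun g y\<bar> \<le> 1" for y
      proof -
        have "0 \<le> apply_bcontfun f y" "apply_bcontfun f y \<le> 1" "0 \<le> apply_bcontfun g y" "apply_bcontfun g y \<le> 1"
          using f g by (auto simp: bumps_def)
        then show ?thesis
          by linarith
      qed
      then have "norm (f - g) \<le> 1"
        by (intro norm_bound) simp
      then have "\<bar>blinfun_apply \<phi> (f - g)\<bar> \<le> e / 2"
        by (intro U(3)[of _ "V \<inter> W"]) (use f g VW in \<open>auto simp: bumps_def\<close>)
      then show ?thesis
        using \<open>e > 0\<close> by (simp add: dist_real_def blinfun.diff_right)
    qed
    then show "\<exists>P. eventually P (bump_filter x) \<and>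
        (\<forall>f g. P f \<and> P g \<longrightarrow> dist (blinfun_apply \<phi> f) (blinfun_apply \<phi> g) < e)"
      using U by (intro exI[of _ "\<lambda>f. f \<in> bumps U x"]) (auto simp: eventually_bump_filter)
  qed
  then have "\<exists>c. filtermap (blinfun_apply \<phi>) (bump_filter x) \<le> nhds c"
    by (rule cauchy_filter_complete_converges[of _ UNIV])
      (auto simp: complete_UNIV filtermap_bot_iff bump_filter_not_bot[OF K])
  then obtain c where "(blinfun_apply \<phi> \<longlongrightarrow> c) (bump_filter x)"
    unfolding filterlim_def by blast
  then show ?thesis
    unfolding mass_def using tendsto_Lim bump_filter_not_bot[OF K] by metis
qed

lemma mass_eqI:
  fixes x :: "'k::t2_space"
  assumes "compact (UNIV :: 'k set)" "(blinfun_apply \<phi> \<longlongrightarrow> c) (bump_filter x)"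
  shows "mass x \<phi> = c"
  using tendsto_unique bump_filter_not_bot tendsto_mass assms by metis

text \<open>Linearity passes to the limit, and so does the norm bound because bumps have norm at
  most 1. Thus \<open>mass x\<close> belongs to the bidual and is weakly continuous.\<close>

lemma bounded_linear_mass:
  fixes x :: "'k::t2_space"
  assumes K: "compact (UNIV :: 'k set)"
  shows "bounded_linear (mass x)"
proof (rule bounded_linear_intro)
  fix \<phi> \<psi> :: "('k \<Rightarrow>\<^sub>C real) dual" and r :: real
  show "mass x (\<phi> + \<psi>) = mass x \<phi> + mass x \<psi>"
    unfolding mass_eqI[OF K, of "\<phi> + \<psi>", unfolded plus_blinfun.rep_eq, OF tendsto_add[OF tendsto_mass[OF K] tendsto_mass[OF K]]] ..
  show "mass x (r *\<^sub>R \<phi>) = r *\<^sub>R mass x \<phi>"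
    unfolding mass_eqI[OF K, of "r *\<^sub>R \<phi>", unfolded scaleR_blinfun.rep_eq, OF tendsto_scaleR[OF tendsto_const tendsto_mass[OF K]]] ..
  have "eventually (\<lambda>f. norm (blinfun_apply \<phi> f) \<le> norm \<phi>) (bump_filter x)"
    unfolding eventually_bump_filter
  proof (intro exI[of _ UNIV] conjI ballI)
    fix f assume "f \<in> bumps UNIV x"
    then show "norm (blinfun_apply \<phi> f) \<le> norm \<phi>"
      using norm_blinfun[of \<phi> f] mult_left_le[of "norm f" "norm \<phi>"] norm_bump_le[of f UNIV x] by simp
  qed auto
  then show "norm (mass x \<phi>) \<le> norm \<phi> * 1"
    using Lim_norm_ubound[OF bump_filter_not_bot[OF K] tendsto_mass[OF K]] by simp
qed

lemma bounded_linear_in_range_blinfun_apply: "bounded_linear f \<Longrightarrow> f \<in> range blinfun_apply"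
  by (metis bounded_linear_Blinfun_apply rangeI)

lemma blinfun_mass:
  fixes x :: "'k::t2_space"
  assumes "compact (UNIV :: 'k set)"
  shows "mass x \<in> range blinfun_apply"
  by (rule bounded_linear_in_range_blinfun_apply[OF bounded_linear_mass[OF assms]])

lemma finite_disjoint_neighbourhoods:
  fixes F :: "'k::t2_space set"
  assumes "finite F"
  obtains N where "\<And>x. open (N x)" "\<And>x. x \<in> N x" "\<And>x y. x \<in> F \<Longrightarrow> y \<in> F \<Longrightarrow> x \<noteq> y \<Longrightarrow> N x \<inter> N y = {}"
proof -
  have "\<forall>p :: 'k \<times> 'k. \<exists>q. fst p \<noteq> snd p \<longrightarrow> open (fst q) \<and> open (snd q) \<and> fst p \<in> fst q \<and> snd p \<in> snd q \<and> fst q \<inter> snd q = {}"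
    using hausdorff by (metis fst_conv snd_conv)
  from choice[OF this] obtain Q :: "'k \<times> 'k \<Rightarrow> 'k set \<times> 'k set" where
    Q: "\<And>x y. x \<noteq> y \<Longrightarrow> open (fst (Q (x, y))) \<and> open (snd (Q (x, y))) \<and> x \<in> fst (Q (x, y)) \<and>
      y \<in> snd (Q (x, y)) \<and> fst (Q (x, y)) \<inter> snd (Q (x, y)) = {}"
    by auto
  \<comment> \<open>Both orders of a pair enter, since \<open>Q (x, y)\<close> and
    \<open>Q (y, x)\<close> are chosen independently of each other.\<close>
  define N where "N x = (\<Inter>y\<in>F - {x}. fst (Q (x, y)) \<inter> snd (Q (y, x)))" for x
  show ?thesis
  proof
    show "open (N x)" for x
      unfolding N_def using assms Q by (intro open_INT) (auto intro!: open_Int)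
    show "x \<in> N x" for x
      unfolding N_def using Q by (intro INT_I) (metis DiffD2 Int_iff singletonI)
    show "N x \<inter> N y = {}" if "x \<in> F" "y \<in> F" "x \<noteq> y" for x y
    proof -
      have "N x \<subseteq> fst (Q (x, y))" "N y \<subseteq> snd (Q (x, y))"
        using that unfolding N_def by auto
      then show ?thesis
        using Q[OF that(3)] by blast
    qed
  qed
qed

text \<open>The functional is tested on a sum of bumps with disjoint supports, each carrying the
  sign of the mass at its point. The sum has norm at most 1, and its value is close to the sum of
  the absolute masses.\<close>

lemma sum_mass_le_norm:
  fixes F :: "'k::t2_space set"
  assumes K: "compact (UNIV :: 'k set)" and F: "finite F"
  shows "(\<Sum>x\<in>F. \<bar>mass x \<phi>\<bar>) \<le> norm \<phi>"
proof (rule field_le_epsilon)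
  fix e :: real assume "e > 0"
  \<comment> \<open>The error allowed per point; adding 1 keeps the denominator positive when
    \<open>F\<close> is empty.\<close>
  define d where "d = e / (real (card F) + 1)"
  have d: "d > 0" "real (card F) * d \<le> e"
    using \<open>e > 0\<close> by (auto simp: d_def field_simps)
  obtain N where N: "\<And>x. open (N x)" "\<And>x. x \<in> N x" "\<And>x y. x \<in> F \<Longrightarrow> y \<in> F \<Longrightarrow> x \<noteq> y \<Longrightarrow> N x \<inter> N y = {}"
    using finite_disjoint_neighbourhoods[OF F] by metis
  have "\<exists>f. \<bar>blinfun_apply \<phi> f - mass x \<phi>\<bar> < d \<and> f \<in> bumps (N x) x" for x
  proof -
    have "eventually (\<lambda>f. dist (blinfun_apply \<phi> f) (mass x \<phi>) < d) (bump_filter x)"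
      using tendsto_mass[OF K] d(1) by (rule tendstoD)
    moreover have "eventually (\<lambda>f. f \<in> bumps (N x) x) (bump_filter x)"
      unfolding eventually_bump_filter using N by blast
    ultimately show ?thesis
      using eventually_happens'[OF bump_filter_not_bot[OF K] eventually_conj] by (fastforce simp: dist_real_def)
  qed
  then obtain f where f: "\<And>x. \<bar>blinfun_apply \<phi> (f x) - mass x \<phi>\<bar> < d" "\<And>x. f x \<in> bumps (N x) x"
    by metis
  define g where "g = (\<Sum>x\<in>F. sgn (mass x \<phi>) *\<^sub>R f x)"
  have g_apply: "apply_bcontfun g y = (\<Sum>x\<in>F. sgn (mass x \<phi>) * apply_bcontfun (f x) y)" for y
    unfolding g_def by (induction F rule: infinite_finite_induct) auto
  have "norm g \<le> 1"
  proof (rule norm_bound)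
    fix y
    show "norm (apply_bcontfun g y) \<le> 1"
    proof (cases "\<exists>x\<in>F. y \<in> N x")
      case True
      then obtain x where x: "x \<in> F" "y \<in> N x"
        by blast
      have "apply_bcontfun (f z) y = 0" if "z \<in> F - {x}" for z
        using N(3)[of x z] f(2)[of z] that x by (auto simp: bumps_def)
      then have "apply_bcontfun g y = sgn (mass x \<phi>) * apply_bcontfun (f x) y"
        unfolding g_apply by (subst sum.remove[OF F x(1)]) simp
      then show ?thesis
        using f(2)[of x] by (simp add: bumps_def abs_mult sgn_real_def)
    next
      case False
      then have "apply_bcontfun (f z) y = 0" if "z \<in> F" for z
        using that f(2)[of z] by (auto simp: bumps_def)
      then show ?thesis
        unfolding g_apply by simp
    qed
  qed
  have "(\<Sum>x\<in>F. \<bar>mass x \<phi>\<bar>) - real (card F) * d = (\<Sum>x\<in>F. \<bar>mass x \<phi>\<bar> - d)"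
    by (simp add: sum_subtractf)
  also have "\<dots> \<le> (\<Sum>x\<in>F. sgn (mass x \<phi>) * blinfun_apply \<phi> (f x))"
  proof (rule sum_mono)
    fix x assume "x \<in> F"
    show "\<bar>mass x \<phi>\<bar> - d \<le> sgn (mass x \<phi>) * blinfun_apply \<phi> (f x)"
      using f(1)[of x] d(1) by (auto simp: sgn_real_def)
  qed
  also have "\<dots> = blinfun_apply \<phi> g"
    by (simp add: g_def blinfun.sum_right blinfun.scaleR_right)
  also have "\<dots> \<le> norm \<phi>"
    using norm_blinfun[of \<phi> g] mult_left_le[of "norm g" "norm \<phi>"] \<open>norm g \<le> 1\<close> by simp
  finally show "(\<Sum>x\<in>F. \<bar>mass x \<phi>\<bar>) \<le> norm \<phi> + e"
    using d(2) by simp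
qed

section \<open>Point evaluations and functionals determined by their masses\<close>

definition dirac :: "'k::topological_space \<Rightarrow> ('k \<Rightarrow>\<^sub>C real) dual"
  where "dirac x = Blinfun (\<lambda>f. apply_bcontfun f x)"

lemma dirac_apply [simp]: "blinfun_apply (dirac x) f = apply_bcontfun f x"
proof -
  have "bounded_linear (\<lambda>f :: 'a \<Rightarrow>\<^sub>C real. apply_bcontfun f x)"
    by (rule bounded_linear_intro[of _ 1]) (simp_all add: abs_apply_bcontfun_le)
  then show ?thesis
    by (simp add: dirac_def bounded_linear_Blinfun_apply)
qed

lemma norm_dirac_le: "norm (dirac x) \<le> 1"
  by (rule norm_blinfun_bound) (simp_all add: abs_apply_bcontfun_le)

text \<open>Along the filter the values are eventually constant: every bump at \<open>x\<close> is 1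
  at \<open>x\<close>, and a bump supported off \<open>y\<close> is 0 at \<open>y\<close>.\<close>

lemma mass_dirac:
  fixes x y :: "'k::t2_space"
  assumes K: "compact (UNIV :: 'k set)"
  shows "mass x (dirac y) = (if x = y then 1 else 0)"
proof (rule mass_eqI[OF K tendsto_eventually])
  show "eventually (\<lambda>f. blinfun_apply (dirac y) f = (if x = y then 1 else 0)) (bump_filter x)"
    unfolding eventually_bump_filter
    by (rule exI[of _ "if x = y then UNIV else - {y}"]) (auto simp: bumps_def)
qed

lemma Urysohn_point:
  fixes x :: "'k::t2_space"
  assumes K: "compact (UNIV :: 'k set)" and "open W" "x \<in> W"
  shows "\<exists>h :: 'k \<Rightarrow>\<^sub>C real. (\<forall>y. 0 \<le> apply_bcontfun h y) \<and> apply_bcontfun h x = 1 \<and>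
    (\<forall>y. y \<notin> W \<longrightarrow> apply_bcontfun h y = 0)"
proof -
  obtain h :: "'k \<Rightarrow>\<^sub>C real" where h: "\<And>y. 0 \<le> apply_bcontfun h y" "\<And>y. apply_bcontfun h y \<le> 1"
    "\<And>y. y \<in> {x} \<Longrightarrow> apply_bcontfun h y = 1" "\<And>y. y \<in> - W \<Longrightarrow> apply_bcontfun h y = 0"
    by (rule Urysohn_bcontfun[OF K, of "{x}" "- W"]) (use assms in auto)
  then show ?thesis
    by (intro exI[of _ h]) auto
qed

definition vanishes_on :: "('k::topological_space \<Rightarrow>\<^sub>C real) dual \<Rightarrow> 'k set \<Rightarrow> bool"
  where "vanishes_on \<phi> W \<longleftrightarrow> (\<forall>k. (\<forall>y. y \<notin> W \<longrightarrow> apply_bcontfun k y = 0) \<longrightarrow> blinfun_apply \<phi> k = 0)"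

text \<open>A partition of unity on the compact set \<open>C\<close> splits a function that vanishes
  off \<open>C\<close> into finitely many pieces, each living on a set where \<open>\<phi>\<close>
  vanishes.\<close>

lemma vanishes_if_locally_vanishes:
  fixes C :: "'k::t2_space set"
  assumes K: "compact (UNIV :: 'k set)" and C: "closed C"
    and local: "\<And>x. x \<in> C \<Longrightarrow> \<exists>W. open W \<and> x \<in> W \<and> vanishes_on \<phi> W"
  shows "vanishes_on \<phi> C"
  unfolding vanishes_on_def
proof (intro allI impI)
  fix h :: "'k \<Rightarrow>\<^sub>C real" assume h: "\<forall>y. y \<notin> C \<longrightarrow> apply_bcontfun h y = 0"
  have "\<forall>x\<in>C. \<exists>W. open W \<and> x \<in> W \<and> vanishes_on \<phi> W"
    using local by simp
  from bchoice[OF this] obtain W where W: "\<And>x. x \<in> C \<Longrightarrow> open (W x)" "\<And>x. x \<in> C \<Longrightarrow> x \<in> W x"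
    "\<And>x. x \<in> C \<Longrightarrow> vanishes_on \<phi> (W x)"
    by auto
  have "\<forall>x\<in>C. \<exists>h :: 'k \<Rightarrow>\<^sub>C real. (\<forall>y. 0 \<le> apply_bcontfun h y) \<and> apply_bcontfun h x = 1 \<and>
      (\<forall>y. y \<notin> W x \<longrightarrow> apply_bcontfun h y = 0)"
    using Urysohn_point[OF K W(1,2)] by simp
  from bchoice[OF this] obtain G :: "'k \<Rightarrow> 'k \<Rightarrow>\<^sub>C real" where
    G: "\<And>x y. x \<in> C \<Longrightarrow> 0 \<le> apply_bcontfun (G x) y" "\<And>x. x \<in> C \<Longrightarrow> apply_bcontfun (G x) x = 1"
      "\<And>x y. x \<in> C \<Longrightarrow> y \<notin> W x \<Longrightarrow> apply_bcontfun (G x) y = 0"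
    by auto
  have "compact C"
    using closed_Int_compact[OF C K] by simp
  moreover have "open {y. 1 / 2 < apply_bcontfun (G x) y}" for x
    by (intro open_Collect_less continuous_on_const continuous_on_apply_bcontfun)
  moreover have "C \<subseteq> (\<Union>x\<in>C. {y. 1 / 2 < apply_bcontfun (G x) y})"
    using G(2) by auto
  ultimately obtain D where D: "D \<subseteq> C" "finite D" "C \<subseteq> (\<Union>x\<in>D. {y. 1 / 2 < apply_bcontfun (G x) y})"
    by (rule compactE_image)
  define s where "s y = (\<Sum>x\<in>D. apply_bcontfun (G x) y)" for y
  have s: "1 / 2 < s y" if y: "y \<in> C" for y
  proof -
    obtain x where x: "x \<in> D" "1 / 2 < apply_bcontfun (G x) y"
      using D(3) y by blast
    have "apply_bcontfun (G x) y \<le> s y"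
      unfolding s_def using D G(1) x(1) by (intro member_le_sum) auto
    then show ?thesis
      using x(2) by simp
  qed
  \<comment> \<open>The cut-off at 1/2 keeps the quotient continuous everywhere. On \<open>C\<close>
    the maximum is \<open>s y\<close>, and off \<open>C\<close> the factor \<open>h\<close> is zero,
    so the pieces still add up to \<open>h\<close>.\<close>
  have "\<forall>x. \<exists>k :: 'k \<Rightarrow>\<^sub>C real. \<forall>y. apply_bcontfun k y = apply_bcontfun h y * apply_bcontfun (G x) y / max (s y) (1 / 2)"
  proof
    fix x
    have "continuous_on UNIV (\<lambda>y. apply_bcontfun h y * apply_bcontfun (G x) y / max (s y) (1 / 2))"
      unfolding s_def
      by (intro continuous_on_divide continuous_on_mult continuous_on_max continuous_on_sum
          continuous_on_const continuous_on_apply_bcontfun) (auto simp: max_def)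
    then show "\<exists>k :: 'k \<Rightarrow>\<^sub>C real. \<forall>y. apply_bcontfun k y = apply_bcontfun h y * apply_bcontfun (G x) y / max (s y) (1 / 2)"
      by (rule ex_bcontfun[OF K]) blast
  qed
  from choice[OF this] obtain k :: "'k \<Rightarrow> 'k \<Rightarrow>\<^sub>C real"
    where k: "\<And>x y. apply_bcontfun (k x) y = apply_bcontfun h y * apply_bcontfun (G x) y / max (s y) (1 / 2)"
    by auto
  have "h = (\<Sum>x\<in>D. k x)"
  proof (rule bcontfun_eqI)
    fix y
    have "apply_bcontfun (\<Sum>x\<in>D. k x) y = (\<Sum>x\<in>D. apply_bcontfun (k x) y)"
      by (induction D rule: infinite_finite_induct) auto
    also have "\<dots> = apply_bcontfun h y * s y / max (s y) (1 / 2)"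
      unfolding k s_def by (simp add: sum_divide_distrib sum_distrib_left)
    also have "\<dots> = apply_bcontfun h y"
      using s[of y] h by (cases "y \<in> C") auto
    finally show "apply_bcontfun h y = apply_bcontfun (\<Sum>x\<in>D. k x) y" ..
  qed
  moreover have "blinfun_apply \<phi> (k x) = 0" if "x \<in> D" for x
  proof -
    have "vanishes_on \<phi> (W x)"
      using W(3) D(1) that by blast
    moreover have "\<forall>y. y \<notin> W x \<longrightarrow> apply_bcontfun (k x) y = 0"
      using G(3) D(1) that unfolding k by auto
    ultimately show ?thesis
      unfolding vanishes_on_def by blast
  qed
  ultimately show "blinfun_apply \<phi> h = 0"
    by (simp add: blinfun.sum_right)
qed

text \<open>
  An isolated point \<open>x\<close> of the support of \<open>\<phi>\<close> would carry nonzero mass, since near \<open>x\<close> only the value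
  at \<open>x\<close> of the test function matters.
\<close>

lemma eq_zero_of_mass_eq_zero:
  fixes \<phi> :: "('k::t2_space \<Rightarrow>\<^sub>C real) dual"
  assumes K: "compact (UNIV :: 'k set)"
    and scattered: "\<And>S :: 'k set. closed S \<Longrightarrow> S \<noteq> {} \<Longrightarrow> \<exists>x\<in>S. \<not> x islimpt S"
    and mass: "\<And>x. mass x \<phi> = 0"
  shows "\<phi> = 0"
proof -
  \<comment> \<open>\<open>S\<close> is the support of \<open>\<phi>\<close>.\<close>
  define S where "S = - \<Union>{W. open W \<and> vanishes_on \<phi> W}"
  have "closed S"
    unfolding S_def by (intro closed_Compl open_Union) auto
  have off_S: "\<exists>W. open W \<and> x \<in> W \<and> vanishes_on \<phi> W" if "x \<notin> S" for x
    using that unfolding S_def by blast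
  have "S = {}"
  proof (rule ccontr)
    assume "S \<noteq> {}"
    then obtain x where x: "x \<in> S" "\<not> x islimpt S"
      using scattered \<open>closed S\<close> by blast
    then obtain U where U: "open U" "x \<in> U" "\<And>y. y \<in> S \<Longrightarrow> y \<in> U \<Longrightarrow> y = x"
      unfolding islimpt_def by blast
    obtain V where V: "open V" "x \<in> V" "closure V \<subseteq> U"
      using regular_compact_t2[OF K U(1,2)] by blast
    \<comment> \<open>Such a \<open>k\<close> lives on \<open>closure V - T\<close>, a closed set
      that misses the support because \<open>x\<close> is the only point of \<open>S\<close> in
      \<open>U\<close>.\<close>
    have punctured: "blinfun_apply \<phi> k = 0"
      if k: "\<And>y. y \<notin> V \<Longrightarrow> apply_bcontfun k y = 0" and T: "open T" "x \<in> T" "\<And>y. y \<in> T \<Longrightarrow> apply_bcontfun k y = 0" for k T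
    proof -
      have "vanishes_on \<phi> (closure V - T)"
      proof (rule vanishes_if_locally_vanishes[OF K])
        show "closed (closure V - T)"
          using T(1) by (simp add: closed_Diff)
        fix y assume "y \<in> closure V - T"
        then have "y \<notin> S"
          using U(3)[of y] V(3) T(2) by blast
        then show "\<exists>W. open W \<and> y \<in> W \<and> vanishes_on \<phi> W"
          by (rule off_S)
      qed
      moreover have "apply_bcontfun k y = 0" if "y \<notin> closure V - T" for y
        using that k T(3) closure_subset[of V] by blast
      ultimately show ?thesis
        unfolding vanishes_on_def by blast
    qed
    have "vanishes_on \<phi> V"
      unfolding vanishes_on_def
    proof (intro allI impI)
      fix k :: "'k \<Rightarrow>\<^sub>C real" assume k: "\<forall>y. y \<notin> V \<longrightarrow> apply_bcontfun k y = 0"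
      define c where "c = apply_bcontfun k x"
      \<comment> \<open>Chosen so that \<open>d = e / b\<close> bounds both error terms below,
        \<open>norm \<phi> * d\<close> and \<open>\<bar>c\<bar> * d\<close>, by \<open>e\<close> in
        total; the 1 keeps \<open>b\<close> positive.\<close>
      define b where "b = norm \<phi> + \<bar>c\<bar> + 1"
      have "\<bar>blinfun_apply \<phi> k\<bar> \<le> e" if "e > 0" for e
      proof -
        define d where "d = e / b"
        have b: "b \<ge> 1"
          by (simp add: b_def)
        have d: "d > 0" "d * b = e"
          using \<open>e > 0\<close> b by (auto simp: d_def)
        define N where "N = {y. \<bar>apply_bcontfun k y - c\<bar> < d}"
        have N: "open N" "x \<in> N"
          unfolding N_def using d(1)
          by (auto simp: c_def intro!: open_Collect_less continuous_intros)
        have "eventually (\<lambda>f. dist (blinfun_apply \<phi> f) 0 < d) (bump_filter x)"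
          using tendsto_mass[OF K, of \<phi> x] d(1) unfolding mass by (rule tendstoD)
        moreover have "eventually (\<lambda>f. f \<in> bumps N x) (bump_filter x)"
          unfolding eventually_bump_filter using N by blast
        ultimately have "\<exists>f. dist (blinfun_apply \<phi> f) 0 < d \<and> f \<in> bumps N x"
          by (intro eventually_happens'[OF bump_filter_not_bot[OF K] eventually_conj])
        then obtain f where f: "\<bar>blinfun_apply \<phi> f\<bar> < d" "f \<in> bumps N x"
          by (auto simp: dist_real_def)
        \<comment> \<open>Decomposition of \<open>k\<close> into \<open>q\<close>,
          \<open>c *\<^sub>R f\<close> and \<open>r\<close>: \<open>q\<close> is small because
          \<open>k\<close> is close to \<open>c\<close> on \<open>N\<close>, \<open>\<phi>\<close>
          is small on \<open>f\<close> because the mass at \<open>x\<close> is 0, and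
          \<open>\<phi>\<close> is zero on \<open>r\<close> because \<open>r\<close> vanishes near
          \<open>x\<close>.\<close>
        obtain q :: "'k \<Rightarrow>\<^sub>C real" where q: "\<And>y. apply_bcontfun q y = (apply_bcontfun k y - c) * apply_bcontfun f y"
          by (rule ex_bcontfun[OF K, of "\<lambda>y. (apply_bcontfun k y - c) * apply_bcontfun f y"])
            (intro continuous_intros continuous_on_apply_bcontfun, blast)
        define r where "r = k - (q + c *\<^sub>R f)"
        have r: "apply_bcontfun r y = apply_bcontfun k y * (1 - apply_bcontfun f y)" for y
          by (simp add: r_def q algebra_simps)
        obtain T where T: "open T" "x \<in> T" "\<forall>y\<in>T. apply_bcontfun f y = 1"
          using f(2) by (auto simp: bumps_def)
        have "blinfun_apply \<phi> r = 0"
          by (rule punctured[of _ T]) (use k T in \<open>auto simp: r\<close>)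
        then have "blinfun_apply \<phi> k = blinfun_apply \<phi> q + c * blinfun_apply \<phi> f"
          by (simp add: r_def blinfun.diff_right blinfun.add_right blinfun.scaleR_right)
        moreover have "norm q \<le> d"
        proof (rule norm_bound)
          fix y
          show "norm (apply_bcontfun q y) \<le> d"
          proof (cases "y \<in> N")
            case True
            then have "\<bar>apply_bcontfun k y - c\<bar> * \<bar>apply_bcontfun f y\<bar> \<le> d * 1"
              using f(2) d(1) by (intro mult_mono) (auto simp: N_def bumps_def)
            then show ?thesis
              by (simp add: q abs_mult)
          next
            case False
            then show ?thesis
              using f(2) d(1) by (simp add: q bumps_def)
          qed
        qed
        then have "\<bar>blinfun_apply \<phi> q\<bar> \<le> norm \<phi> * d"
          using norm_blinfun[of \<phi> q] mult_left_mono[of "norm q" d "norm \<phi>"] by simp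
        moreover have "\<bar>c * blinfun_apply \<phi> f\<bar> \<le> \<bar>c\<bar> * d"
          using f(1) by (simp add: abs_mult mult_left_mono)
        moreover have "e = norm \<phi> * d + \<bar>c\<bar> * d + d"
          using d(2) by (simp add: b_def algebra_simps)
        ultimately show ?thesis
          using d(1) by linarith
      qed
      then show "blinfun_apply \<phi> k = 0"
        using dense_ge[of 0 "\<bar>blinfun_apply \<phi> k\<bar>"] by fastforce
    qed
    then show False
      using x(1) V(1,2) unfolding S_def by blast
  qed
  then have "vanishes_on \<phi> UNIV"
    using off_S by (intro vanishes_if_locally_vanishes[OF K]) auto
  then show ?thesis
    by (intro blinfun_eqI) (simp add: vanishes_on_def)
qed

text \<open>The series of point masses of \<open>\<phi>\<close> converges absolutely to some
  \<open>\<psi>\<close> of norm at most \<open>B\<close> with the same masses as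
  \<open>\<phi>\<close>. By \<open>zero\<close>, masses determine a functional, so
  \<open>\<phi> = \<psi>\<close>. With the reverse estimate this identifies the dual norm with the
  \<open>\<ell>\<^sup>1\<close> norm of the masses.\<close>

lemma norm_le_of_sum_mass_le:
  fixes \<phi> :: "('k::t2_space \<Rightarrow>\<^sub>C real) dual"
  assumes K: "compact (UNIV :: 'k set)"
    and zero: "\<And>\<phi> :: ('k \<Rightarrow>\<^sub>C real) dual. (\<And>x. mass x \<phi> = 0) \<Longrightarrow> \<phi> = 0"
    and B: "\<And>F. finite F \<Longrightarrow> (\<Sum>x\<in>F. \<bar>mass x \<phi>\<bar>) \<le> B"
  shows "norm \<phi> \<le> B"
proof -
  define t where "t x = mass x \<phi> *\<^sub>R dirac x" for x
  have norm_t: "norm (t x) \<le> \<bar>mass x \<phi>\<bar>" for x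
    unfolding t_def using norm_dirac_le[of x] by (simp add: mult_left_le)
  have sum_t: "(\<Sum>x\<in>F. norm (t x)) \<le> B" if "finite F" for F
    using sum_mono[of F "\<lambda>x. norm (t x)" "\<lambda>x. \<bar>mass x \<phi>\<bar>"] norm_t B[OF that] by force
  then have "(\<lambda>x. norm (t x)) summable_on UNIV"
    by (intro nonneg_bdd_above_summable_on bdd_aboveI2[where M = B]) auto
  then have "t summable_on UNIV"
    by (rule abs_summable_summable)
  then obtain \<psi> where \<psi>: "(t has_sum \<psi>) UNIV"
    by (auto simp: summable_on_def)
  have "mass y \<psi> = mass y \<phi>" for y
  proof (rule has_sum_unique)
    show "((\<lambda>x. mass y (t x)) has_sum mass y \<psi>) UNIV"
      using bounded_linear_mass[OF K] \<psi> by (rule has_sum_bounded_linear)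
    have "mass y (t x) = mass x \<phi> * (if y = x then 1 else 0)" for x
      unfolding t_def using bounded_linear_mass[OF K, of y] mass_dirac[OF K, of y x]
      by (simp add: linear_simps)
    then show "((\<lambda>x. mass y (t x)) has_sum mass y \<phi>) UNIV"
      by (intro has_sum_finite_neutralI[of "{y}"]) auto
  qed
  then have "mass y (\<phi> - \<psi>) = 0" for y
    using bounded_linear_mass[OF K, of y] by (simp add: linear_simps)
  then have "\<phi> = \<psi>"
    using zero[of "\<phi> - \<psi>"] by simp
  moreover have "norm \<psi> \<le> B"
  proof (rule Lim_norm_ubound)
    show "(sum t \<longlongrightarrow> \<psi>) (finite_subsets_at_top UNIV)"
      using \<psi> by (simp add: has_sum_def)
    show "eventually (\<lambda>F. norm (sum t F) \<le> B) (finite_subsets_at_top UNIV)"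
      using norm_sum[of t] sum_t by (intro eventually_finite_subsets_at_top_weakI) (meson order_trans)
  qed simp
  ultimately show ?thesis
    by simp
qed

subsection \<open>Borel sets of the weak and the norm topology\<close>

lemma topspace_initial_topology:
  assumes "F \<noteq> {}"
  shows "topspace (initial_topology F) = UNIV"
proof -
  obtain f where "f \<in> F"
    using assms by blast
  then have "f -` UNIV \<in> {f -` U | f U. f \<in> F \<and> open U}"
    by blast
  then show ?thesis
    unfolding initial_topology_def topology_generated_by_topspace by blast
qed

lemma openin_initial_topology: "f \<in> F \<Longrightarrow> open U \<Longrightarrow> openin (initial_topology F) (f -` U)"
  unfolding initial_topology_def by (rule topology_generated_by_Basis) blast

lemma open_vimage_initial_topology:
  assumes "\<And>f. f \<in> F \<Longrightarrow> continuous_on UNIV (\<lambda>x. f (g x))" and "openin (initial_topology F) U"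
  shows "open (g -` U)"
  using openin_topology_generated_by[OF assms(2)[unfolded initial_topology_def]]
proof induction
  case (Int a b)
  then show ?case
    by (simp add: open_Int)
next
  case (UN \<K>)
  then show ?case
    by (auto simp: vimage_Union)
next
  case (Basis s)
  then obtain f V where "s = f -` V" "f \<in> F" "open V"
    by blast
  moreover from this have "open ((\<lambda>x. f (g x)) -` V)"
    using assms(1) by (intro open_vimage) auto
  ultimately show ?case
    by (simp add: vimage_def)
qed simp

lemma Bo_vimage:
  assumes "topspace T = UNIV" "\<And>U. openin T U \<Longrightarrow> open (g -` U)" "B \<in> Bo T"
  shows "g -` B \<in> Bo euclidean"
  using assms(3) unfolding Bo_euclidean Bo_def assms(1)
proof induction
  case (Basic U)
  then show ?case
    using assms(2) by (auto intro: sigma_sets.Basic)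
next
  case (Compl a)
  then show ?case
    by (simp add: vimage_Diff sigma_sets.Compl)
next
  case (Union a)
  then show ?case
    by (simp add: vimage_UN sigma_sets.Union)
qed (simp add: sigma_sets.Empty)

text \<open>A norm-open set is a countable union of sets, each the intersection of a
  \<open>T\<close>-open set with a ball; balls are \<open>T\<close>-closed, so all these sets are
  Borel for \<open>T\<close>.\<close>

lemma Bo_eq_of_Kadec:
  fixes T :: "'e::real_normed_vector topology"
  assumes top_T: "topspace T = UNIV" and coarser: "\<And>U. openin T U \<Longrightarrow> open U"
    and ball: "\<And>r. closedin T {x. norm x \<le> r}"
    and Kadec: "\<And>x e. e > 0 \<Longrightarrow> \<exists>W d. openin T W \<and> x \<in> W \<and> d > 0 \<and>
      (\<forall>y\<in>W. norm y < norm x + d \<longrightarrow> dist y x < e)"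
  shows "Bo T = Bo euclidean"
proof
  show "Bo T \<subseteq> Bo euclidean"
    unfolding Bo_def top_T topspace_euclidean
    by (rule sigma_sets_subseteq) (use coarser in auto)
  interpret sigma_algebra UNIV "Bo T"
    unfolding Bo_def top_T by (rule sigma_algebra_sigma_sets) simp
  have open_Bo: "W \<in> Bo T" if "openin T W" for W
    using that unfolding Bo_def by (simp add: sigma_sets.Basic)
  have ball_Bo: "{x. norm x \<le> r} \<in> Bo T" for r
  proof -
    have "- {x. norm x \<le> r} \<in> Bo T"
      using ball[of r] unfolding closedin_def top_T Compl_eq_Diff_UNIV by (intro open_Bo) simp
    then show ?thesis
      using compl_sets by (metis Compl_eq_Diff_UNIV double_compl)
  qed
  have "U \<in> Bo T" if "open U" for U
  proof -
    \<comment> \<open>The largest \<open>T\<close>-open set whose part in the ball of radius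
      \<open>s\<close> lies in \<open>U\<close>.\<close>
    define W where "W s = \<Union>{V. openin T V \<and> V \<inter> {x. norm x \<le> s} \<subseteq> U}" for s
    have "U = (\<Union>s\<in>\<rat>. W s \<inter> {x. norm x \<le> s})"
    proof
      show "U \<subseteq> (\<Union>s\<in>\<rat>. W s \<inter> {x. norm x \<le> s})"
      proof
        fix x assume "x \<in> U"
        then obtain e where e: "e > 0" "\<And>y. dist y x < e \<Longrightarrow> y \<in> U"
          using \<open>open U\<close> unfolding open_dist by blast
        obtain V d where V: "openin T V" "x \<in> V" "d > 0" "\<forall>y\<in>V. norm y < norm x + d \<longrightarrow> dist y x < e"
          using Kadec[OF e(1)] by blast
        \<comment> \<open>The ball of rational radius \<open>s\<close> contains \<open>x\<close>,
          yet is small enough for the Kadec condition to hold on all of its intersection with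
          \<open>V\<close>; rational radii keep the union countable.\<close>
        obtain s where s: "s \<in> \<rat>" "norm x < s" "s < norm x + d"
          using Rats_dense_in_real[of "norm x" "norm x + d"] V(3) by auto
        have "V \<inter> {x. norm x \<le> s} \<subseteq> U"
          using V(4) s(3) e(2) by auto
        then have "x \<in> W s"
          unfolding W_def using V(1,2) by blast
        then show "x \<in> (\<Union>s\<in>\<rat>. W s \<inter> {x. norm x \<le> s})"
          using s by auto
      qed
    qed (auto simp: W_def)
    moreover have "openin T (W s)" for s
      unfolding W_def by (rule openin_Union) auto
    then have "W s \<inter> {x. norm x \<le> s} \<in> Bo T" for s
      by (intro Int open_Bo ball_Bo)
    then have "(\<Union>s\<in>\<rat>. W s \<inter> {x. norm x \<le> s}) \<in> Bo T"
      by (intro countable_UN'' countable_rat)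
    ultimately show ?thesis
      by simp
  qed
  then show "Bo euclidean \<subseteq> Bo T"
    unfolding Bo_euclidean by (intro sigma_sets_subset) auto
qed

section \<open>The weak topology on the dual of C(K)\<close>

lemma topspace_weak_topology [simp]: "topspace weak_topology = UNIV"
  unfolding weak_topology_def by (rule topspace_initial_topology) simp

lemma topspace_weak_star_topology [simp]: "topspace weak_star_topology = UNIV"
  unfolding weak_star_topology_def by (rule topspace_initial_topology) simp

lemma openin_weak_mass:
  fixes x :: "'k::t2_space"
  assumes "compact (UNIV :: 'k set)" "open U"
  shows "openin weak_topology (mass x -` U)"
  unfolding weak_topology_def using blinfun_mass[OF assms(1)] assms(2) by (rule openin_initial_topology)

text \<open>For nonnegative \<open>r\<close> the ball is an intersection of conditions on single
  values \<open>blinfun_apply \<phi> x\<close>, and evaluation at \<open>x\<close> is weakly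
  continuous on the dual. For negative \<open>r\<close> the ball is empty.\<close>

lemma closedin_weak_dual_ball: "closedin weak_topology {\<phi> :: ('e::real_normed_vector) dual. norm \<phi> \<le> r}"
proof (cases "r \<ge> 0")
  case True
  have eval: "(\<lambda>\<phi> :: 'e dual. blinfun_apply \<phi> x) \<in> range blinfun_apply" for x
    by (rule bounded_linear_in_range_blinfun_apply[OF blinfun.bounded_linear_left])
  have "closedin weak_topology {\<phi> :: 'e dual. \<bar>blinfun_apply \<phi> x\<bar> \<le> r * norm x}" for x
  proof -
    have "openin weak_topology ((\<lambda>\<phi> :: 'e dual. blinfun_apply \<phi> x) -` (- {- (r * norm x)..r * norm x}))"
      unfolding weak_topology_def by (rule openin_initial_topology[OF eval]) (simp add: open_Compl)
    moreover have "UNIV - {\<phi> :: 'e dual. \<bar>blinfun_apply \<phi> x\<bar> \<le> r * norm x} =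
        (\<lambda>\<phi> :: 'e dual. blinfun_apply \<phi> x) -` (- {- (r * norm x)..r * norm x})"
      by (auto simp: abs_le_iff)
    ultimately show ?thesis
      by (simp add: closedin_def)
  qed
  moreover have "{\<phi> :: 'e dual. norm \<phi> \<le> r} = (\<Inter>x. {\<phi>. \<bar>blinfun_apply \<phi> x\<bar> \<le> r * norm x})"
  proof (intro equalityI subsetI INT_I CollectI)
    fix \<phi> :: "'e dual" and x
    assume "\<phi> \<in> {\<phi>. norm \<phi> \<le> r}"
    then show "\<bar>blinfun_apply \<phi> x\<bar> \<le> r * norm x"
      using norm_blinfun[of \<phi> x] mult_right_mono[of "norm \<phi>" r "norm x"] by simp
  next
    fix \<phi> :: "'e dual"
    assume "\<phi> \<in> (\<Inter>x. {\<phi>. \<bar>blinfun_apply \<phi> x\<bar> \<le> r * norm x})"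
    then show "norm \<phi> \<le> r"
      using True by (intro norm_blinfun_bound) auto
  qed
  ultimately show ?thesis
    by (simp add: closedin_INT)
next
  case False
  then have "\<not> norm \<phi> \<le> r" for \<phi> :: "'e dual"
    using norm_ge_zero[of \<phi>] by linarith
  then show ?thesis
    by simp
qed

lemma open_if_openin_weak: "openin weak_topology U \<Longrightarrow> open U"
  using open_vimage_initial_topology[of "range blinfun_apply" "\<lambda>x. x" U]
    linear_continuous_on[OF blinfun.bounded_linear_right]
  by (auto simp: weak_topology_def vimage_def)

text \<open>This is the Kadec argument in \<open>\<ell>\<^sup>1\<close>: a finite set
  \<open>F\<close> carries almost all of the norm of \<open>\<phi>\<close>. If \<open>\<psi>\<close>
  has nearly the same masses on \<open>F\<close> and a norm that is hardly larger, little of it is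
  left outside \<open>F\<close>.\<close>

lemma Bo_weak_eq_Bo_norm:
  assumes K: "compact (UNIV :: 'k::t2_space set)" and Bo: "Bo (euclidean :: 'k topology) = Pow UNIV"
  shows "Bo (weak_topology :: ('k \<Rightarrow>\<^sub>C real) dual topology) = Bo euclidean"
proof (rule Bo_eq_of_Kadec)
  fix \<phi> :: "('k \<Rightarrow>\<^sub>C real) dual" and e :: real
  assume "e > 0"
  have scattered: "\<exists>x\<in>S. \<not> x islimpt S" if "closed S" "S \<noteq> {}" for S :: "'k set"
    by (rule scattered_of_Bo_eq_Pow[OF K Bo that]) blast
  have zero: "\<psi> = 0" if "\<And>x. mass x \<psi> = 0" for \<psi> :: "('k \<Rightarrow>\<^sub>C real) dual"
    by (rule eq_zero_of_mass_eq_zero[OF K scattered that])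
  \<comment> \<open>The final estimate is \<open>5 * d\<close>: less than \<open>3 * d\<close> from
    \<open>\<psi>\<close> outside \<open>F\<close>, less than \<open>d\<close> from
    \<open>\<phi>\<close> outside \<open>F\<close>, and at most \<open>d\<close> from their
    difference on \<open>F\<close>. The sixth part makes the inequality strict.\<close>
  define d where "d = e / 6"
  have "d > 0"
    using \<open>e > 0\<close> by (simp add: d_def)
  \<comment> \<open>If all finite sums stayed at or below \<open>norm \<phi> - d\<close>, so would
    the norm itself.\<close>
  obtain F where F: "finite F" "(\<Sum>x\<in>F. \<bar>mass x \<phi>\<bar>) > norm \<phi> - d"
  proof -
    have "\<not> (\<forall>F. finite F \<longrightarrow> (\<Sum>x\<in>F. \<bar>mass x \<phi>\<bar>) \<le> norm \<phi> - d)"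
      using norm_le_of_sum_mass_le[OF K zero, of \<phi> "norm \<phi> - d"] \<open>d > 0\<close> by force
    then show ?thesis
      using that by force
  qed
  define c where "c = d / (real (card F) + 1)"
  have c: "c > 0" "real (card F) * c \<le> d"
    using \<open>d > 0\<close> by (auto simp: c_def field_simps)
  define W where "W = UNIV \<inter> (\<Inter>x\<in>F. mass x -` ball (mass x \<phi>) c)"
  have "openin weak_topology W"
  proof (cases "F = {}")
    case True
    then show ?thesis
      unfolding W_def using openin_topspace[of weak_topology] by simp
  next
    case False
    then show ?thesis
      unfolding W_def using F(1) openin_weak_mass[OF K] by auto
  qed
  moreover have "\<phi> \<in> W"
    using c(1) by (simp add: W_def)
  moreover have "dist \<psi> \<phi> < e" if \<psi>: "\<psi> \<in> W" "norm \<psi> < norm \<phi> + d" for \<psi>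
  proof -
    have diff: "mass x (\<psi> - \<phi>) = mass x \<psi> - mass x \<phi>" for x
      using bounded_linear_mass[OF K, of x] by (simp add: linear_simps)
    have close: "(\<Sum>x\<in>F. \<bar>mass x \<psi> - mass x \<phi>\<bar>) \<le> d"
    proof -
      have "(\<Sum>x\<in>F. \<bar>mass x \<psi> - mass x \<phi>\<bar>) \<le> (\<Sum>x\<in>F. c)"
        using \<psi>(1) by (intro sum_mono) (force simp: W_def dist_real_def)
      then show ?thesis
        using c(2) by simp
    qed
    have "(\<Sum>x\<in>F. \<bar>mass x \<phi>\<bar>) \<le> (\<Sum>x\<in>F. \<bar>mass x \<psi>\<bar> + \<bar>mass x \<psi> - mass x \<phi>\<bar>)"
      by (rule sum_mono) linarith
    then have F\<psi>: "(\<Sum>x\<in>F. \<bar>mass x \<psi>\<bar>) > norm \<phi> - 2 * d"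
      using F(2) close by (simp add: sum.distrib)
    have "norm (\<psi> - \<phi>) \<le> 5 * d"
    proof (rule norm_le_of_sum_mass_le[OF K zero])
      fix G :: "'k set" assume G: "finite G"
      have rest: "(\<Sum>x\<in>G - F. \<bar>mass x \<theta>\<bar>) \<le> norm \<theta> - (\<Sum>x\<in>F. \<bar>mass x \<theta>\<bar>)" for \<theta> :: "('k \<Rightarrow>\<^sub>C real) dual"
      proof -
        have "(\<Sum>x\<in>(G - F) \<union> F. \<bar>mass x \<theta>\<bar>) \<le> norm \<theta>"
          using G F(1) by (intro sum_mass_le_norm[OF K]) auto
        then show ?thesis
          using G F(1) by (subst (asm) sum.union_disjoint) auto
      qed
      have "(\<Sum>x\<in>G. \<bar>mass x (\<psi> - \<phi>)\<bar>) \<le> (\<Sum>x\<in>(G - F) \<union> F. \<bar>mass x (\<psi> - \<phi>)\<bar>)"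
        using G F(1) by (intro sum_mono2) auto
      also have "\<dots> = (\<Sum>x\<in>G - F. \<bar>mass x \<psi> - mass x \<phi>\<bar>) + (\<Sum>x\<in>F. \<bar>mass x \<psi> - mass x \<phi>\<bar>)"
        using G F(1) by (subst sum.union_disjoint) (auto simp: diff)
      also have "(\<Sum>x\<in>G - F. \<bar>mass x \<psi> - mass x \<phi>\<bar>) \<le> (\<Sum>x\<in>G - F. \<bar>mass x \<psi>\<bar> + \<bar>mass x \<phi>\<bar>)"
        by (rule sum_mono) linarith
      finally show "(\<Sum>x\<in>G. \<bar>mass x (\<psi> - \<phi>)\<bar>) \<le> 5 * d"
        using rest[of \<psi>] rest[of \<phi>] close F(2) F\<psi> \<psi>(2) by (simp add: sum.distrib)
    qed
    then show ?thesis
      using \<open>d > 0\<close> by (simp add: dist_norm d_def)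
  qed
  ultimately show "\<exists>W d. openin weak_topology W \<and> \<phi> \<in> W \<and> d > 0 \<and>
      (\<forall>\<psi>\<in>W. norm \<psi> < norm \<phi> + d \<longrightarrow> dist \<psi> \<phi> < e)"
    using \<open>d > 0\<close> by blast
qed (use open_if_openin_weak closedin_weak_dual_ball in auto)

lemma Bo_eq_Pow_of_Bo_weak_star_eq:
  assumes K: "compact (UNIV :: 'k::t2_space set)"
    and eq: "Bo (weak_star_topology :: ('k \<Rightarrow>\<^sub>C real) dual topology) = Bo weak_topology"
  shows "Bo (euclidean :: 'k topology) = Pow UNIV"
proof -
  have "A \<in> Bo euclidean" for A :: "'k set"
  proof -
    \<comment> \<open>The threshold 1/2 separates the two values 0 and 1 of
      \<open>mass x (dirac y)\<close>, so \<open>dirac y\<close> lies in \<open>U\<close> exactly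
      when \<open>y\<close> lies in \<open>A\<close>.\<close>
    define U where "U = (\<Union>x\<in>A. mass x -` {1 / 2 <..})"
    have "openin weak_topology U"
      unfolding U_def using openin_weak_mass[OF K] by (intro openin_Union) auto
    then have "U \<in> Bo weak_topology"
      by (simp add: Bo_def sigma_sets.Basic)
    then have "U \<in> Bo weak_star_topology"
      using eq by simp
    \<comment> \<open>Evaluation at a function composed with \<open>dirac\<close> gives back that
      function, which is continuous.\<close>
    moreover have "open (dirac -` V)" if "openin weak_star_topology V" for V :: "('k \<Rightarrow>\<^sub>C real) dual set"
      using that unfolding weak_star_topology_def
      by (rule open_vimage_initial_topology[rotated]) auto
    ultimately have "dirac -` U \<in> Bo euclidean"
      by (intro Bo_vimage[of weak_star_topology]) auto
    moreover have "dirac -` U = A"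
      by (auto simp: U_def mass_dirac[OF K] split: if_splits)
    ultimately show ?thesis
      by simp
  qed
  then show ?thesis
    by blast
qed

theorem corollary3p4:
  assumes "compact (UNIV :: 'k::t2_space set)"
  shows "(Bo (euclidean :: 'k topology) = Pow UNIV \<longrightarrow>
            Bo (weak_topology :: ('k \<Rightarrow>\<^sub>C real) dual topology)
              = Bo (euclidean :: ('k \<Rightarrow>\<^sub>C real) dual topology)) \<and>
         (Bo (weak_star_topology :: ('k \<Rightarrow>\<^sub>C real) dual topology)
              = Bo (weak_topology :: ('k \<Rightarrow>\<^sub>C real) dual topology) \<longrightarrow>
            Bo (weak_star_topology :: ('k \<Rightarrow>\<^sub>C real) dual topology)
              = Bo (euclidean :: ('k \<Rightarrow>\<^sub>C real) dual topology))"
proof (intro conjI impI)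
  assume "Bo (euclidean :: 'k topology) = Pow UNIV"
  then show "Bo (weak_topology :: ('k \<Rightarrow>\<^sub>C real) dual topology) = Bo euclidean"
    by (rule Bo_weak_eq_Bo_norm[OF assms])
next
  assume eq: "Bo (weak_star_topology :: ('k \<Rightarrow>\<^sub>C real) dual topology) = Bo weak_topology"
  show "Bo (weak_star_topology :: ('k \<Rightarrow>\<^sub>C real) dual topology) = Bo euclidean"
    unfolding eq by (rule Bo_weak_eq_Bo_norm[OF assms Bo_eq_Pow_of_Bo_weak_star_eq[OF assms eq]])
qed

end
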